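(* Let $\Lambda=\langle a_1\rangle\perp\langle a_2\rangle=\mathcal{O}_Ds_1\perp\mathcal{O}_Ds_2$ be a skew-hermitian lattice with $|2a_1|\ge|a_2|$ and $N(a_2)\in N(a_1)k^{*2}$, and let $t$ be the integer with $\nu(\pi^t)=\mu(\Lambda)=\nu(a_2)-\nu(a_1)$. The following are equivalent: (1) $H(\Lambda)=k^*$; (2) there exists $(s;\sigma)\in\mathcal{B}(\Lambda)$ with $N(\sigma)\notin N(k(a_1)^* )$; (3) there exists $r\in\mathcal{O}_D$ such that $\left(\frac{N(1-r),\,-N(a_1)}{\mathfrak{p}}\right)=-1$, $N(z)N(a_1)\in k^{*2}$ and $N(z)N(\pi^ta_1)^{-1}\in\mathcal{O}_k$, where $z=a_1-ra_1\bar r$.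
   Context: $k$ is a dyadic local field of characteristic $0$ with ring of integers $\mathcal{O}_k$, uniformizer $\pi$, normalized valuation $\nu_k$; $\left(\frac{x,y}{\mathfrak{p}}\right)$ is the Hilbert symbol of $k$. $D$ is the quaternion division algebra over $k$, with involution $q\mapsto\bar q$, reduced norm $N$; $|q|:=|N(q)|_k$, $\nu(q):=\nu_k(N(q))$, $\mathcal{O}_D=\{q:|q|\le 1\}$. A skew-hermitian space is a free $D$-module $V$ with nondegenerate $h$, $D$-linear in the first variable, $h(x,y)=-\overline{h(y,x)}$; $\langle a_1\rangle\perp\langle a_2\rangle=\mathcal{O}_Ds_1\perp\mathcal{O}_Ds_2$ means $h(s_i,s_i)=a_i$ (pure quaternions), $h(s_1,s_2)=0$. Simple rotation: for $s\in V$, $\sigma\in D^*$ with $\sigma-\bar\sigma=h(s,s)$, $(s;\sigma)(x)=x-h(x,s)\sigma^{-1}s$; the spinor norm $\theta$ on the isometry group satisfies $\theta((s;\sigma))=N(\sigma)k^{*2}$. $\mathcal{U}^+_k(\Lambda)$ is the stabilizer of $\Lambda$ in the isometry group; $H(\Lambda)\supseteq k^{*2}$ is defined by $H(\Lambda)/k^{*2}=\theta(\mathcal{U}^+_k(\Lambda))$. $\mathcal{B}(\Lambda)$ is the set of simple rotations $(s;\sigma)\in\mathcal{U}^+_k(\Lambda)$ for which there exist $m\in\{1,2\}$, $r\in\mathcal{O}_D$ with $|1-r|\ge|2|$, and $s_0\in\mathcal{O}_Ds_{m+1}\perp\cdots$ (i.e. $s_0=\lambda s_2$ with $\lambda\in\mathcal{O}_D$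 if $m=1$, $s_0=0$ if $m=2$) such that $s=(1-r)s_m-s_0$ and $\sigma=a_m(1-\bar r)$. *)

theory Defs
  imports Complex_Main
begin

section \<open>Dyadic local fields of characteristic 0\<close>

text \<open>The field k is a type of class field_char_0; the (normalized, discrete)
valuation is a function v :: k => int, whose value at 0 is irrelevant (junk).\<close>

definition discrete_valuation :: "('k::field \<Rightarrow> int) \<Rightarrow> bool" where
  "discrete_valuation v \<longleftrightarrow>
     (\<forall>x y. x \<noteq> 0 \<longrightarrow> y \<noteq> 0 \<longrightarrow> v (x * y) = v x + v y) \<and>
     (\<forall>x y. x \<noteq> 0 \<longrightarrow> y \<noteq> 0 \<longrightarrow> x + y \<noteq> 0 \<longrightarrow> min (v x) (v y) \<le> v (x + y)) \<and>
     (\<forall>n. \<exists>x. x \<noteq> 0 \<and> v x = n)"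

definition int_ring :: "('k::field \<Rightarrow> int) \<Rightarrow> 'k set" where
  "int_ring v = {x. x = 0 \<or> 0 \<le> v x}"

definition max_ideal :: "('k::field \<Rightarrow> int) \<Rightarrow> 'k set" where
  "max_ideal v = {x. x = 0 \<or> 1 \<le> v x}"

definition residue_field :: "('k::field \<Rightarrow> int) \<Rightarrow> 'k set set" where
  "residue_field v = int_ring v // {(x, y). x \<in> int_ring v \<and> y \<in> int_ring v \<and> x - y \<in> max_ideal v}"

definition residue_card :: "('k::field \<Rightarrow> int) \<Rightarrow> nat" where
  "residue_card v = card (residue_field v)"

definition v_cauchy :: "('k::field \<Rightarrow> int) \<Rightarrow> (nat \<Rightarrow> 'k) \<Rightarrow> bool" where
  "v_cauchy v x \<longleftrightarrow> (\<forall>M. \<exists>N. \<forall>m\<ge>N. \<forall>n\<ge>N. x m = x n \<or> M \<le> v (x m - x n))"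

definition v_converges :: "('k::field \<Rightarrow> int) \<Rightarrow> (nat \<Rightarrow> 'k) \<Rightarrow> 'k \<Rightarrow> bool" where
  "v_converges v x L \<longleftrightarrow> (\<forall>M. \<exists>N. \<forall>n\<ge>N. x n = L \<or> M \<le> v (x n - L))"

definition v_complete :: "('k::field \<Rightarrow> int) \<Rightarrow> bool" where
  "v_complete v \<longleftrightarrow> (\<forall>x. v_cauchy v x \<longrightarrow> (\<exists>L. v_converges v x L))"

text \<open>A dyadic local field of characteristic 0: complete w.r.t. a normalized discrete
valuation, finite residue field, and 2 in the maximal ideal.\<close>
definition dyadic_local_field :: "('k::field_char_0 \<Rightarrow> int) \<Rightarrow> bool" where
  "dyadic_local_field v \<longleftrightarrow> discrete_valuation v \<and> v_complete v \<and>
     finite (residue_field v) \<and> 1 \<le> v (2::'k)"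

text \<open>normalized absolute value |x|_k = q^(-v x), q = size of the residue field\<close>
definition absk :: "('k::field \<Rightarrow> int) \<Rightarrow> 'k \<Rightarrow> real" where
  "absk v x = (if x = 0 then 0 else real (residue_card v) powr (- real_of_int (v x)))"

definition nonzero_squares :: "'k::field set" where
  "nonzero_squares = {c * c | c. c \<noteq> 0}"

text \<open>Hilbert symbol: 1 if z^2 = x u^2 + y w^2 has a nontrivial solution, else -1.\<close>
definition hilbert :: "'k::field \<Rightarrow> 'k \<Rightarrow> int" where
  "hilbert x y = (if \<exists>u w z. (u, w, z) \<noteq> (0, 0, 0) \<and> z * z = x * u * u + y * w * w
                  then 1 else -1)"

section \<open>Quaternion algebras (alpha, beta)_k\<close>

text \<open>Quat x0 x1 x2 x3 = x0 + x1 i + x2 j + x3 ij, with i^2 = alpha, j^2 = beta, ij = -ji.\<close>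
datatype 'k quat = Quat 'k 'k 'k 'k

fun qadd :: "'k::field quat \<Rightarrow> 'k quat \<Rightarrow> 'k quat" where
  "qadd (Quat x0 x1 x2 x3) (Quat y0 y1 y2 y3) = Quat (x0+y0) (x1+y1) (x2+y2) (x3+y3)"

fun qneg :: "'k::field quat \<Rightarrow> 'k quat" where
  "qneg (Quat x0 x1 x2 x3) = Quat (-x0) (-x1) (-x2) (-x3)"

definition qsub :: "'k::field quat \<Rightarrow> 'k quat \<Rightarrow> 'k quat" where
  "qsub x y = qadd x (qneg y)"

definition qscal :: "'k::field \<Rightarrow> 'k quat" where
  "qscal c = Quat c 0 0 0"

definition qzero :: "'k::field quat" where "qzero = qscal 0"
definition qone :: "'k::field quat" where "qone = qscal 1"

fun qmul :: "'k::field \<times> 'k \<Rightarrow> 'k quat \<Rightarrow> 'k quat \<Rightarrow> 'k quat" where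
  "qmul (\<alpha>, \<beta>) (Quat x0 x1 x2 x3) (Quat y0 y1 y2 y3) =
     Quat (x0*y0 + \<alpha>*x1*y1 + \<beta>*x2*y2 - \<alpha>*\<beta>*x3*y3)
          (x0*y1 + x1*y0 - \<beta>*x2*y3 + \<beta>*x3*y2)
          (x0*y2 + x2*y0 + \<alpha>*x1*y3 - \<alpha>*x3*y1)
          (x0*y3 + x3*y0 + x1*y2 - x2*y1)"

text \<open>canonical involution\<close>
fun qconj :: "'k::field quat \<Rightarrow> 'k quat" where
  "qconj (Quat x0 x1 x2 x3) = Quat x0 (-x1) (-x2) (-x3)"

text \<open>reduced norm\<close>
fun qnorm :: "'k::field \<times> 'k \<Rightarrow> 'k quat \<Rightarrow> 'k" where
  "qnorm (\<alpha>, \<beta>) (Quat x0 x1 x2 x3) = x0*x0 - \<alpha>*x1*x1 - \<beta>*x2*x2 + \<alpha>*\<beta>*x3*x3"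

definition qsmult :: "'k::field \<Rightarrow> 'k quat \<Rightarrow> 'k quat" where
  "qsmult c q = qmul (0, 0) (qscal c) q"

definition qinv :: "'k::field \<times> 'k \<Rightarrow> 'k quat \<Rightarrow> 'k quat" where
  "qinv A q = qsmult (inverse (qnorm A q)) (qconj q)"

text \<open>(alpha,beta)_k is a division algebra iff its norm form is anisotropic\<close>
definition quat_division :: "'k::field \<times> 'k \<Rightarrow> bool" where
  "quat_division A \<longleftrightarrow> (\<forall>q. qnorm A q = 0 \<longrightarrow> q = qzero)"

definition pure_quat :: "'k::field quat \<Rightarrow> bool" where
  "pure_quat q \<longleftrightarrow> qconj q = qneg q"

text \<open>|q| := |N(q)|_k and nu(q) := nu_k(N(q))\<close>
definition qabs :: "('k::field \<Rightarrow> int) \<Rightarrow> 'k \<times> 'k \<Rightarrow> 'k quat \<Rightarrow> real" where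
  "qabs v A q = absk v (qnorm A q)"

definition qval :: "('k::field \<Rightarrow> int) \<Rightarrow> 'k \<times> 'k \<Rightarrow> 'k quat \<Rightarrow> int" where
  "qval v A q = v (qnorm A q)"

definition O_D :: "('k::field \<Rightarrow> int) \<Rightarrow> 'k \<times> 'k \<Rightarrow> 'k quat set" where
  "O_D v A = {q. qabs v A q \<le> 1}"

text \<open>norms from k(a)^*, a a pure quaternion\<close>
definition norms_from :: "'k::field \<times> 'k \<Rightarrow> 'k quat \<Rightarrow> 'k set" where
  "norms_from A a = {qnorm A (qadd (qscal x) (qsmult y a)) | x y. (x, y) \<noteq> (0, 0)}"

section \<open>The skew-hermitian space V = D s1 + D s2 with h(s_i,s_i) = a_i\<close>

type_synonym 'k vec = "'k quat \<times> 'k quat"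

definition vsmult :: "'k::field \<times> 'k \<Rightarrow> 'k quat \<Rightarrow> 'k vec \<Rightarrow> 'k vec" where
  "vsmult A d x = (qmul A d (fst x), qmul A d (snd x))"

definition vadd :: "'k::field vec \<Rightarrow> 'k vec \<Rightarrow> 'k vec" where
  "vadd x y = (qadd (fst x) (fst y), qadd (snd x) (snd y))"

definition vsub :: "'k::field vec \<Rightarrow> 'k vec \<Rightarrow> 'k vec" where
  "vsub x y = (qsub (fst x) (fst y), qsub (snd x) (snd y))"

definition vzero :: "'k::field vec" where "vzero = (qzero, qzero)"
definition s1 :: "'k::field vec" where "s1 = (qone, qzero)"
definition s2 :: "'k::field vec" where "s2 = (qzero, qone)"

text \<open>h(x,y) = x1 a1 conj(y1) + x2 a2 conj(y2)\<close>
definition hform :: "'k::field \<times> 'k \<Rightarrow> 'k quat \<Rightarrow> 'k quat \<Rightarrow> 'k vec \<Rightarrow> 'k vec \<Rightarrow> 'k quat" where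
  "hform A a1 a2 x y =
     qadd (qmul A (qmul A (fst x) a1) (qconj (fst y)))
          (qmul A (qmul A (snd x) a2) (qconj (snd y)))"

text \<open>the lattice O_D s1 + O_D s2\<close>
definition lattice :: "('k::field \<Rightarrow> int) \<Rightarrow> 'k \<times> 'k \<Rightarrow> 'k vec set" where
  "lattice v A = {x. fst x \<in> O_D v A \<and> snd x \<in> O_D v A}"

definition isometry :: "'k::field \<times> 'k \<Rightarrow> 'k quat \<Rightarrow> 'k quat \<Rightarrow> ('k vec \<Rightarrow> 'k vec) \<Rightarrow> bool" where
  "isometry A a1 a2 g \<longleftrightarrow> bij g \<and>
     (\<forall>d x y. g (vadd (vsmult A d x) y) = vadd (vsmult A d (g x)) (g y)) \<and>
     (\<forall>x y. hform A a1 a2 (g x) (g y) = hform A a1 a2 x y)"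

text \<open>U^+_k(Lambda): stabilizer of the lattice in the isometry group\<close>
definition stab :: "('k::field \<Rightarrow> int) \<Rightarrow> 'k \<times> 'k \<Rightarrow> 'k quat \<Rightarrow> 'k quat \<Rightarrow> ('k vec \<Rightarrow> 'k vec) set" where
  "stab v A a1 a2 = {g. isometry A a1 a2 g \<and> g ` lattice v A = lattice v A}"

text \<open>data (s, sigma) of a simple rotation: sigma in D^*, sigma - conj sigma = h(s,s)\<close>
definition rot_data :: "'k::field \<times> 'k \<Rightarrow> 'k quat \<Rightarrow> 'k quat \<Rightarrow> 'k vec \<times> 'k quat \<Rightarrow> bool" where
  "rot_data A a1 a2 p \<longleftrightarrow> snd p \<noteq> qzero \<and>
     qsub (snd p) (qconj (snd p)) = hform A a1 a2 (fst p) (fst p)"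

text \<open>(s;sigma)(x) = x - h(x,s) sigma^{-1} s\<close>
definition rot :: "'k::field \<times> 'k \<Rightarrow> 'k quat \<Rightarrow> 'k quat \<Rightarrow> 'k vec \<times> 'k quat \<Rightarrow> 'k vec \<Rightarrow> 'k vec" where
  "rot A a1 a2 p x = vsub x (vsmult A (qmul A (hform A a1 a2 x (fst p)) (qinv A (snd p))) (fst p))"

text \<open>H(Lambda): the set of c in k^* such that c k^{*2} = theta(g) for some g in U^+(Lambda);
theta(g) is computed from a factorization of g into simple rotations as the product of
the N(sigma_i) modulo squares.\<close>
definition Hgrp :: "('k::field \<Rightarrow> int) \<Rightarrow> 'k \<times> 'k \<Rightarrow> 'k quat \<Rightarrow> 'k quat \<Rightarrow> 'k set" where
  "Hgrp v A a1 a2 = {c. c \<noteq> 0 \<and> (\<exists>ps. list_all (rot_data A a1 a2) ps \<and>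
      foldr (\<circ>) (map (rot A a1 a2) ps) id \<in> stab v A a1 a2 \<and>
      (\<exists>e. e \<noteq> 0 \<and> prod_list (map (\<lambda>p. qnorm A (snd p)) ps) = c * (e * e)))}"

text \<open>the set B(Lambda), as a set of rotation data (s, sigma)\<close>
definition Bset :: "('k::field \<Rightarrow> int) \<Rightarrow> 'k \<times> 'k \<Rightarrow> 'k quat \<Rightarrow> 'k quat \<Rightarrow> ('k vec \<times> 'k quat) set" where
  "Bset v A a1 a2 = {(s, \<sigma>). rot_data A a1 a2 (s, \<sigma>) \<and> rot A a1 a2 (s, \<sigma>) \<in> stab v A a1 a2 \<and>
     (\<exists>r \<in> O_D v A. qabs v A (qsub qone r) \<ge> qabs v A (qscal 2) \<and>
       ((\<exists>l \<in> O_D v A. s = vsub (vsmult A (qsub qone r) s1) (vsmult A l s2)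
                        \<and> \<sigma> = qmul A a1 (qsub qone (qconj r))) \<or>
        (s = vsub (vsmult A (qsub qone r) s2) vzero \<and> \<sigma> = qmul A a2 (qsub qone (qconj r)))))}"

end

theory Submission
  imports Defs
begin

text \<open>
  Put \<open>K = k(a\<^sub>1)\<close>. Rotations of the line through \<open>s\<^sub>1\<close> show that \<open>H(\<Lambda>)\<close> contains \<open>N(K\<^sup>*)\<close>, a subgroup
  of index 2 in \<open>k\<^sup>*\<close>, so \<open>H(\<Lambda>) = k\<^sup>*\<close> iff some \<open>g\<close> in the stabilizer has spinor norm outside it.
  If \<open>g s\<^sub>1 = r s\<^sub>1 + \<lambda> s\<^sub>2\<close> with \<open>r \<noteq> 1\<close>, the simple rotation with
  \<open>s = (1 - r) s\<^sub>1 - \<lambda> s\<^sub>2\<close> and \<open>\<sigma> = a\<^sub>1 (1 - conj r)\<close> agrees with \<open>g\<close> at \<open>s\<^sub>1\<close>; what remains fixes \<open>s\<^sub>1\<close> and is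
  a rotation of the line through \<open>s\<^sub>2\<close> with spinor norm in \<open>N(k(a\<^sub>2)\<^sup>*) = N(K\<^sup>*)\<close>. Hence the spinor norm of \<open>g\<close> is in
  \<open>N(K\<^sup>*)\<close> iff \<open>N(1 - r)\<close> is. Replacing \<open>g\<close> by \<open>-g\<close> one may assume \<open>|1 - r| \<ge> |2|\<close>, and then
  \<open>|a\<^sub>2| \<le> |2 a\<^sub>1|\<close> makes this rotation preserve the lattice.

  The spinor norm is well defined on products of rotations because \<open>V\<close> is a hyperbolic plane: in hyperbolic
  coordinates every rotation has the form \<open>x \<mapsto> (x G) d\<close> with \<open>G \<in> GL\<^sub>2(k)\<close>, \<open>d \<in> D\<^sup>*\<close> and
  \<open>N(d) \<equiv> N(\<sigma>)\<close> modulo squares.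

  The equation \<open>a\<^sub>1 - r a\<^sub>1 conj r = \<lambda> a\<^sub>2 conj \<lambda>\<close> is solvable in \<open>\<lambda> \<in> D\<close> iff the norms agree modulo squares,
  once more because \<open>N(K\<^sup>*)\<close> has index 2; this links \<open>\<B>(\<Lambda>)\<close> with condition (3).
\<close>

section \<open>Complete discrete valuations and the residue field\<close>

text \<open>\<open>v 0\<close> is junk, so this form treats the valuation of \<open>0\<close> as
  infinite and makes the ultrametric rules unconditional.\<close>

definition vge :: "('k::field \<Rightarrow> int) \<Rightarrow> int \<Rightarrow> 'k \<Rightarrow> bool" where
  "vge v M x \<longleftrightarrow> x = 0 \<or> M \<le> v x"

locale dyadic =
  fixes v :: "'k::field_char_0 \<Rightarrow> int"
  assumes dyadic: "dyadic_local_field v"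
begin

lemma v_mult: "x \<noteq> 0 \<Longrightarrow> y \<noteq> 0 \<Longrightarrow> v (x * y) = v x + v y"
  and v_add: "x \<noteq> 0 \<Longrightarrow> y \<noteq> 0 \<Longrightarrow> x + y \<noteq> 0 \<Longrightarrow> min (v x) (v y) \<le> v (x + y)"
  and complete: "v_cauchy v X \<Longrightarrow> \<exists>L. v_converges v X L"
  and finite_residue: "finite (residue_field v)"
  and v_two: "1 \<le> v 2"
  using dyadic unfolding dyadic_local_field_def discrete_valuation_def v_complete_def by blast+

lemma v_one [simp]: "v 1 = 0"
  using v_mult[of 1 1] by simp

lemma v_neg [simp]: "v (- x) = v x"
proof (cases "x = 0")
  case False
  have "v (-1) = 0" using v_mult[of "-1" "-1"] by simp
  then show ?thesis using False v_mult[of "-1" x] by simp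
qed simp

lemma v_inverse: "x \<noteq> 0 \<Longrightarrow> v (inverse x) = - v x"
  using v_mult[of x "inverse x"] by simp

lemma v_divide: "x \<noteq> 0 \<Longrightarrow> y \<noteq> 0 \<Longrightarrow> v (x / y) = v x - v y"
  by (simp add: divide_inverse v_mult v_inverse)

lemma vge_zero [simp]: "vge v M 0" and vge_neg [simp]: "vge v M (- x) \<longleftrightarrow> vge v M x"
  and vge_one [simp]: "vge v 0 1"
  by (auto simp: vge_def)

lemma vge_mono: "vge v M x \<Longrightarrow> N \<le> M \<Longrightarrow> vge v N x"
  by (auto simp: vge_def)

lemma vge_add: "vge v M x \<Longrightarrow> vge v M y \<Longrightarrow> vge v M (x + y)"
  using v_add[of x y] by (fastforce simp: vge_def)

lemma vge_diff: "vge v M x \<Longrightarrow> vge v M y \<Longrightarrow> vge v M (x - y)"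
  using vge_add[of M x "- y"] by simp

lemma vge_mult: "vge v M x \<Longrightarrow> vge v N y \<Longrightarrow> vge v (M + N) (x * y)"
  by (cases "x = 0"; cases "y = 0") (auto simp: vge_def v_mult)

lemma vge_mult0: "vge v M x \<Longrightarrow> vge v 0 y \<Longrightarrow> vge v M (x * y)"
  using vge_mult[of M x 0 y] by simp

lemma vge_mult1: "vge v 0 x \<Longrightarrow> vge v M y \<Longrightarrow> vge v M (x * y)"
  using vge_mult[of 0 x M y] by simp

lemma vge_divide: "vge v M x \<Longrightarrow> y \<noteq> 0 \<Longrightarrow> vge v (M - v y) (x / y)"
  by (cases "x = 0") (auto simp: vge_def v_divide)

lemma vge_square_iff: "vge v (2 * M) (x * x) \<longleftrightarrow> vge v M x"
  by (cases "x = 0") (auto simp: vge_def v_mult)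

lemma unit_plus_small:
  assumes "u \<noteq> 0" "v u = 0" "vge v 1 x"
  shows "u + x \<noteq> 0" "v (u + x) = 0"
proof -
  show nz: "u + x \<noteq> 0"
    using assms by (auto simp: vge_def add_eq_0_iff)
  have 1: "vge v 0 (u + x)" using assms by (intro vge_add) (auto simp: vge_def)
  have "\<not> vge v 1 (u + x)"
    using vge_diff[of 1 "u + x" x] assms by (auto simp: vge_def)
  then show "v (u + x) = 0" using 1 nz by (auto simp: vge_def)
qed

text \<open>Iterating \<open>z \<mapsto> 1 + c * z * z\<close> from \<open>1\<close> stays integral
  and contracts: two images differ by \<open>c\<close> times the difference times the sum of the
  arguments. Each step gains one order, and completeness gives a fixed point.\<close>

lemma hensel_quadratic:
  assumes c: "vge v 1 c"
  shows "\<exists>z. vge v 0 z \<and> z = 1 + c * z * z"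
proof -
  define X where "X = rec_nat (1::'k) (\<lambda>_ z. 1 + c * z * z)"
  have X0: "X 0 = 1" and XS: "\<And>n. X (Suc n) = 1 + c * X n * X n"
    by (auto simp: X_def)
  have c0: "vge v 0 c" using c by (rule vge_mono) simp
  have int: "vge v 0 (X n)" for n
  proof (induction n)
    case (Suc n)
    show ?case unfolding XS
      by (intro vge_add vge_one) (auto intro!: vge_mult0 Suc c0)
  qed (simp add: X0)
  have step: "vge v (int n + 1) (X (Suc n) - X n)" for n
  proof (induction n)
    case 0
    then show ?case using c by (simp add: XS X0)
  next
    case (Suc n)
    have e: "X (Suc (Suc n)) - X (Suc n) = c * ((X (Suc n) - X n) * (X (Suc n) + X n))"
      by (simp add: XS algebra_simps)
    have "vge v (1 + (int n + 1)) (c * ((X (Suc n) - X n) * (X (Suc n) + X n)))"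
      by (intro vge_mult vge_mult0 c Suc vge_add int)
    then show ?case unfolding e by (simp add: algebra_simps)
  qed
  have tail: "vge v (int n + 1) (X (n + j) - X n)" for n j
  proof (induction j)
    case (Suc j)
    have "vge v (int n + 1) ((X (Suc (n + j)) - X (n + j)) + (X (n + j) - X n))"
      by (intro vge_add Suc vge_mono[OF step]) simp
    then show ?case by simp
  qed simp
  have tail2: "vge v (int n + 1) (X m - X n)" if "n \<le> m" for m n
    using tail[of n "m - n"] that by simp
  have "v_cauchy v X"
    unfolding v_cauchy_def
  proof
    fix M
    have "vge v M (X m - X n)" if "m \<ge> nat M" "n \<ge> nat M" for m n
    proof (cases "n \<le> m")
      case True
      show ?thesis by (rule vge_mono[OF tail2[OF True]]) (use that in simp)
    next
      case False
      have "vge v M (- (X n - X m))" unfolding vge_neg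
        by (rule vge_mono[OF tail2]) (use that False in auto)
      then show ?thesis by simp
    qed
    then show "\<exists>N. \<forall>m\<ge>N. \<forall>n\<ge>N. X m = X n \<or> M \<le> v (X m - X n)"
      by (auto simp: vge_def)
  qed
  then obtain z where z: "v_converges v X z" using complete by blast
  have near: "\<exists>N. \<forall>n\<ge>N. vge v M (X n - z)" for M
    using z by (auto simp: v_converges_def vge_def)
  have z0: "vge v 0 z"
  proof -
    obtain n where "vge v 0 (X n - z)" using near by blast
    from vge_diff[OF int[of n] this] show ?thesis by simp
  qed
  have "vge v M (z - (1 + c * z * z))" for M
  proof -
    obtain N where N: "\<And>n. n \<ge> N \<Longrightarrow> vge v M (X n - z)" using near by blast
    have "vge v M ((- (X (Suc N) - z)) + (X N - z) * (c * (X N + z)))"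
      by (intro vge_add vge_mult0[OF N] vge_mult0[OF c0] int z0) (simp_all only: vge_neg, simp_all add: N)
    then show ?thesis by (simp add: XS algebra_simps)
  qed
  \<comment> \<open>A bound beyond the valuation of the difference itself forces the difference to
    vanish.\<close>
  from this[of "v (z - (1 + c * z * z)) + 1"] have "z = 1 + c * z * z"
    by (auto simp: vge_def)
  with z0 show ?thesis by blast
qed

text \<open>The equation \<open>b y\<^sup>2 + y = a\<close> is solvable as soon as \<open>a b\<close> is topologically nilpotent:
  put \<open>y = a z\<close>.\<close>
lemma hensel_solve:
  assumes "vge v 1 (a * b)"
  shows "\<exists>y. (\<forall>M. vge v M a \<longrightarrow> vge v M y) \<and> y + b * y * y = a"
proof -
  have "vge v 1 (- (a * b))" using assms by (simp only: vge_neg)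
  then obtain z where z: "vge v 0 z" "z = 1 + (- (a * b)) * z * z"
    using hensel_quadratic by blast
  have "a * z + b * (a * z) * (a * z) = a * (z - (1 + (- (a * b)) * z * z)) + a"
    by (simp add: algebra_simps)
  then show ?thesis using z vge_mult0[OF _ z(1)] by (intro exI[of _ "a * z"]) auto
qed

section \<open>Arithmetic in the residue field, on integral representatives\<close>

definition cong1 :: "'k \<Rightarrow> 'k \<Rightarrow> bool" where "cong1 x y \<longleftrightarrow> vge v 1 (x - y)"

lemma two_small: "vge v 1 2" by (auto simp: vge_def v_two)

lemma cong1_refl [simp]: "cong1 x x" by (simp add: cong1_def)

lemma cong1_sym: "cong1 x y \<Longrightarrow> cong1 y x"
  using vge_neg[of 1 "x - y"] by (simp add: cong1_def)

lemma cong1_trans: "cong1 x y \<Longrightarrow> cong1 y z \<Longrightarrow> cong1 x z"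
  using vge_add[of 1 "x - y" "y - z"] by (simp add: cong1_def)

lemma cong1_add: "cong1 x y \<Longrightarrow> cong1 x' y' \<Longrightarrow> cong1 (x + x') (y + y')"
  using vge_add[of 1 "x - y" "x' - y'"] by (simp add: cong1_def algebra_simps)

text \<open>Choosing one representative in each class turns the residue field into a finite subset
  of \<open>'k\<close>, on which counting arguments can be run.\<close>

lemma residue_map:
  obtains \<rho> :: "'k \<Rightarrow> 'k" where
    "finite (\<rho> ` {x. vge v 0 x})"
    "\<And>x. vge v 0 x \<Longrightarrow> vge v 0 (\<rho> x) \<and> cong1 (\<rho> x) x"
    "\<And>x y. vge v 0 x \<Longrightarrow> vge v 0 y \<Longrightarrow> \<rho> x = \<rho> y \<longleftrightarrow> cong1 x y"
proof -
  define R where "R = {(x, y). x \<in> int_ring v \<and> y \<in> int_ring v \<and> x - y \<in> max_ideal v}"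
  have R: "(x, y) \<in> R \<longleftrightarrow> vge v 0 x \<and> vge v 0 y \<and> cong1 x y" for x y
    by (auto simp: R_def int_ring_def max_ideal_def vge_def cong1_def)
  have I: "int_ring v = {x. vge v 0 x}" by (auto simp: int_ring_def vge_def)
  have RF: "residue_field v = {x. vge v 0 x} // R"
    by (simp only: residue_field_def R_def I)
  have "equiv {x. vge v 0 x} R"
  proof (rule equivI)
    show "sym R"
    proof (rule symI)
      fix x y assume "(x, y) \<in> R"
      then show "(y, x) \<in> R" using vge_neg[of 1 "x - y"] by (simp add: R cong1_def)
    qed
    show "trans R"
    proof (rule transI)
      fix x y z assume "(x, y) \<in> R" "(y, z) \<in> R"
      then show "(x, z) \<in> R" using vge_add[of 1 "x - y" "y - z"] by (simp add: R cong1_def)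
    qed
  qed (auto simp: refl_on_def R cong1_def)
  note eq = this
  define \<rho> where "\<rho> x = (SOME y. y \<in> R `` {x})" for x
  have in_class: "(x, \<rho> x) \<in> R" if "vge v 0 x" for x
  proof -
    have "x \<in> R `` {x}" using that by (auto simp: R cong1_def)
    from someI[of "\<lambda>y. y \<in> R `` {x}", OF this] show ?thesis by (simp add: \<rho>_def)
  qed
  have img: "\<rho> ` {x. vge v 0 x} \<subseteq> (\<lambda>C. SOME y. y \<in> C) ` residue_field v"
  proof
    fix y assume "y \<in> \<rho> ` {x. vge v 0 x}"
    then obtain x where "vge v 0 x" "y = (SOME y. y \<in> R `` {x})" by (auto simp: \<rho>_def)
    then show "y \<in> (\<lambda>C. SOME y. y \<in> C) ` residue_field v"
      unfolding RF by (auto intro!: image_eqI[of _ _ "R `` {x}"] quotientI)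
  qed
  have fin: "finite (\<rho> ` {x. vge v 0 x})"
    using finite_subset[OF img] finite_residue by simp
  have rep: "vge v 0 (\<rho> x) \<and> cong1 (\<rho> x) x" if "vge v 0 x" for x
    using in_class[OF that] by (simp add: R cong1_sym)
  have inj: "\<rho> x = \<rho> y \<longleftrightarrow> cong1 x y" if "vge v 0 x" "vge v 0 y" for x y
  proof
    assume "\<rho> x = \<rho> y"
    then have "(x, \<rho> x) \<in> R" "(y, \<rho> x) \<in> R" using in_class that by metis+
    then have "(x, y) \<in> R" using eq unfolding equiv_def sym_def trans_def by blast
    then show "cong1 x y" by (simp add: R)
  next
    assume "cong1 x y"
    then have "(x, y) \<in> R" using that by (simp add: R)
    then have "R `` {x} = R `` {y}" using eq by (rule equiv_class_eq[rotated])
    then show "\<rho> x = \<rho> y" by (simp add: \<rho>_def)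
  qed
  show ?thesis using that[of \<rho>] fin rep inj by blast
qed

lemma small_prod:
  assumes "vge v 0 a" "vge v 0 b" "vge v 1 (a * b)"
  shows "vge v 1 a \<or> vge v 1 b"
  using assms by (cases "a = 0"; cases "b = 0") (auto simp: vge_def v_mult)

text \<open>In residue characteristic 2, \<open>a + b\<close> and \<open>a - b\<close> agree modulo
  the maximal ideal, so squaring is injective on residue classes; finiteness makes it
  surjective.\<close>

lemma residue_sqrt:
  assumes x: "vge v 0 x"
  shows "\<exists>w. vge v 0 w \<and> cong1 (w * w) x"
proof -
  obtain \<rho> where fin: "finite (\<rho> ` {x. vge v 0 x})"
    and rep: "\<And>x. vge v 0 x \<Longrightarrow> vge v 0 (\<rho> x) \<and> cong1 (\<rho> x) x"
    and eq: "\<And>x y. vge v 0 x \<Longrightarrow> vge v 0 y \<Longrightarrow> \<rho> x = \<rho> y \<longleftrightarrow> cong1 x y"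
    using residue_map by blast
  let ?R = "\<rho> ` {x. vge v 0 x}" and ?f = "\<lambda>y. \<rho> (y * y)"
  have R0: "vge v 0 y" if "y \<in> ?R" for y using that rep by auto
  have "inj_on ?f ?R"
  proof (rule inj_onI)
    fix a b assume ab: "a \<in> ?R" "b \<in> ?R" "?f a = ?f b"
    have a0: "vge v 0 a" and b0: "vge v 0 b" using R0 ab(1,2) by blast+
    have "vge v 1 (a * a - b * b)"
      using ab(3) eq[OF vge_mult0[OF a0 a0] vge_mult0[OF b0 b0]] by (simp add: cong1_def)
    then have "vge v 1 ((a - b) * (a + b))" by (simp add: algebra_simps)
    then have "vge v 1 (a - b) \<or> vge v 1 (a + b)"
      by (rule small_prod[OF vge_diff[OF a0 b0] vge_add[OF a0 b0]])
    moreover have "vge v 1 (a - b)" if "vge v 1 (a + b)"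
      using vge_diff[OF that vge_mult0[OF two_small b0]] by simp
    ultimately have "cong1 a b" by (auto simp: cong1_def)
    then have "\<rho> a = \<rho> b" using a0 b0 eq by blast
    moreover have "\<rho> y = y" if "y \<in> ?R" for y
      using that rep eq by force
    ultimately show "a = b" using ab by metis
  qed
  moreover have "?f ` ?R \<subseteq> ?R"
    by (intro image_subsetI imageI CollectI vge_mult0 R0)
  ultimately have "?f ` ?R = ?R" using fin by (metis endo_inj_surj)
  then obtain y where y: "y \<in> ?R" "\<rho> x = ?f y" using x by blast
  then have "cong1 x (y * y)" using eq[OF x vge_mult0[OF R0 R0]] by blast
  then show ?thesis using y R0 cong1_sym by blast
qed

text \<open>The fibres of \<open>y \<mapsto> y + y\<^sup>2\<close> on the residue field have at most two elements, so its image has index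
  at most 2.\<close>
lemma residue_artin_schreier:
  assumes a: "vge v 0 a" and b: "vge v 0 b"
  shows "\<exists>y. vge v 0 y \<and> (cong1 (y + y * y) a \<or> cong1 (y + y * y) b \<or> cong1 (y + y * y) (a + b))"
proof -
  obtain \<rho> where fin: "finite (\<rho> ` {x. vge v 0 x})"
    and rep: "\<And>x. vge v 0 x \<Longrightarrow> vge v 0 (\<rho> x) \<and> cong1 (\<rho> x) x"
    and eq: "\<And>x y. vge v 0 x \<Longrightarrow> vge v 0 y \<Longrightarrow> \<rho> x = \<rho> y \<longleftrightarrow> cong1 x y"
    using residue_map by blast
  define R where "R = \<rho> ` {x. vge v 0 x}"
  define f where "f y = \<rho> (y + y * y)" for y
  have finR: "finite R" using fin by (simp add: R_def)
  have R0: "vge v 0 y" if "y \<in> R" for y using that rep by (auto simp: R_def)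
  have fix\<rho>: "\<rho> y = y" if "y \<in> R" for y using that rep eq by (force simp: R_def)
  have q0: "vge v 0 (y + y * y)" if "y \<in> R" for y
    using R0[OF that] by (simp add: vge_add vge_mult0)
  have R_cong: "x = y" if "x \<in> R" "y \<in> R" "cong1 x y" for x y
    using that fix\<rho> R0 eq by metis
  have \<rho>R: "\<rho> x \<in> R" if "vge v 0 x" for x using that by (auto simp: R_def)
  \<comment> \<open>A second point of the fibre through \<open>y\<close> can only be the class of
    \<open>- 1 - y\<close>, since \<open>y' + y' * y' - (y + y * y)\<close> is
    \<open>(y' - y) * (1 + y + y')\<close>.\<close>
  have fibre: "card {y \<in> R. f y = i} \<le> 2" for i
  proof (cases "\<exists>y \<in> R. f y = i")
    case True
    then obtain y where y: "y \<in> R" "f y = i" by blast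
    have "{y' \<in> R. f y' = i} \<subseteq> {y, \<rho> (- 1 - y)}"
    proof
      fix y' assume "y' \<in> {y' \<in> R. f y' = i}"
      then have y': "y' \<in> R" "f y' = f y" using y by auto
      then have "cong1 (y' + y' * y') (y + y * y)"
        using eq q0 y unfolding f_def by blast
      then have "vge v 1 ((y' - y) * (1 + y + y'))" by (simp add: cong1_def algebra_simps)
      then have "vge v 1 (y' - y) \<or> vge v 1 (1 + y + y')"
        using R0[OF y(1)] R0[OF y'(1)] by (intro small_prod) (auto intro!: vge_diff vge_add)
      then show "y' \<in> {y, \<rho> (- 1 - y)}"
      proof
        assume "vge v 1 (y' - y)"
        then show ?thesis using R_cong y' y by (auto simp: cong1_def)
      next
        assume *: "vge v 1 (1 + y + y')"
        have m0: "vge v 0 (- 1 - y)" using R0[OF y(1)] by (intro vge_diff) simp_all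
        have "cong1 y' (- 1 - y)" using * by (simp add: cong1_def algebra_simps)
        then have "\<rho> y' = \<rho> (- 1 - y)" using eq[OF R0[OF y'(1)] m0] by simp
        then show ?thesis using fix\<rho>[OF y'(1)] by simp
      qed
    qed
    then have "card {y' \<in> R. f y' = i} \<le> card {y, \<rho> (- 1 - y)}" by (intro card_mono) auto
    also have "\<dots> \<le> 2" by (simp add: card_insert_if)
    finally show ?thesis .
  next
    case False
    then have none: "{y \<in> R. f y = i} = {}" by blast
    show ?thesis unfolding none by simp
  qed
  have cardR: "card R \<le> 2 * card (f ` R)"
  proof -
    have "card R = (\<Sum>i\<in>f ` R. card {y \<in> R. f y = i})"
      using sum.image_gen[OF finR, of "\<lambda>_. 1::nat" f] by simp
    also have "\<dots> \<le> (\<Sum>i\<in>f ` R. 2)" by (intro sum_mono fibre)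
    finally show ?thesis by simp
  qed
  \<comment> \<open>If a class is both a value \<open>f y\<close> and a reflected value
    \<open>g (f y')\<close>, then \<open>a\<close> is a sum of two Artin-Schreier values. That map
    is additive modulo 2, so \<open>a\<close> is then a value itself.\<close>
  define g where "g x = \<rho> (a - x)" for x
  have fR: "f ` R \<subseteq> R" using q0 \<rho>R by (auto simp: f_def)
  have g0: "vge v 0 (a - x)" if "x \<in> R" for x using R0[OF that] a by (rule vge_diff[rotated])
  have gR: "g ` f ` R \<subseteq> R" using fR g0 \<rho>R by (auto simp: g_def)
  have inj: "inj_on g (f ` R)"
  proof (rule inj_onI)
    fix x y assume *: "x \<in> f ` R" "y \<in> f ` R" "g x = g y"
    then have R: "x \<in> R" "y \<in> R" using fR by auto
    have "cong1 (a - x) (a - y)" using * eq g0 R unfolding g_def by blast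
    then have "cong1 x y" using cong1_sym by (simp add: cong1_def)
    then show "x = y" using R_cong R by blast
  qed
  \<comment> \<open>Pigeonhole: the image of \<open>f\<close> has at least half the elements of
    \<open>R\<close>, so it, its reflection under \<open>g\<close> and one further class cannot be
    disjoint.\<close>
  have sur: "\<rho> b \<in> f ` R \<or> \<rho> b \<in> g ` f ` R \<or> (f ` R \<inter> g ` f ` R \<noteq> {})"
  proof (rule ccontr)
    assume "\<not> ?thesis"
    then have n: "\<rho> b \<notin> f ` R \<union> g ` f ` R" "f ` R \<inter> g ` f ` R = {}" by auto
    have "card (insert (\<rho> b) (f ` R \<union> g ` f ` R)) \<le> card R"
      using fR gR \<rho>R[OF b] by (intro card_mono finR) auto
    moreover have "card (insert (\<rho> b) (f ` R \<union> g ` f ` R)) = 1 + (card (f ` R) + card (g ` f ` R))"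
      using n finR by (simp add: card_Un_disjoint)
    moreover have "card (g ` f ` R) = card (f ` R)" using inj by (rule card_image)
    ultimately show False using cardR by simp
  qed
  have fc: "cong1 (f y) (y + y * y)" if "y \<in> R" for y using rep q0[OF that] by (simp add: f_def)
  have gc: "cong1 (g x) (a - x)" if "x \<in> R" for x using rep g0[OF that] by (simp add: g_def)
  have bc: "cong1 (\<rho> b) b" using rep b by blast
  have neg: "cong1 (- z) z" if "vge v 0 z" for z
    using vge_mult0[OF two_small that] vge_neg[of 1 "2 * z"] by (simp add: cong1_def)
  from sur consider (1) y where "y \<in> R" "\<rho> b = f y" | (2) y where "y \<in> R" "\<rho> b = g (f y)"
    | (3) y y' where "y \<in> R" "y' \<in> R" "f y = g (f y')" by blast
  then show ?thesis
  proof cases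
    case 1
    then have "cong1 (y + y * y) b" using cong1_trans[OF cong1_sym[OF fc] ] bc by metis
    then show ?thesis using R0 1 by blast
  next
    case 2
    then have fy: "f y \<in> R" using fR by blast
    have "cong1 (a - f y) b" using gc[OF fy] bc 2 cong1_sym cong1_trans by metis
    then have "cong1 ((a - f y) + b) (b + - b)" using neg[OF b]
      by (intro cong1_add cong1_sym[of "- b"]) auto
    then have "vge v 1 (a + b - f y)" by (simp add: cong1_def algebra_simps)
    then have "cong1 (f y) (a + b)" using cong1_sym by (auto simp: cong1_def)
    then have "cong1 (y + y * y) (a + b)" using fc[OF 2(1)] cong1_sym cong1_trans by metis
    then show ?thesis using R0 2 by blast
  next
    case 3
    then have fy: "f y' \<in> R" using fR by blast
    have "cong1 (y + y * y) (a - f y')" using gc[OF fy] fc[OF 3(1)] 3 cong1_sym cong1_trans by metis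
    from cong1_add[OF this fc[OF 3(2)]]
    have A: "cong1 (y + y * y + (f y')) (a - f y' + (y' + y' * y'))" .
    have B: "vge v 1 (y + y * y + f y' - (a - f y' + (y' + y' * y')))" using A by (simp add: cong1_def)
    have C: "vge v 1 (f y' - (y' + y' * y'))" using fc[OF 3(2)] by (simp add: cong1_def)
    have y0: "vge v 0 y" "vge v 0 y'" using 3 R0 by auto
    have "vge v 1 (((y + y') + (y + y') * (y + y')) - a)"
      using vge_add[OF vge_diff[OF vge_diff[OF B C] C] vge_mult0[OF two_small vge_mult0[OF y0]]]
      by (simp add: algebra_simps)
    then show ?thesis using vge_add[OF y0] unfolding cong1_def by blast
  qed
qed

text \<open>The classes of \<open>0\<close> and \<open>1\<close> differ. A base above 1 is what
  makes \<open>absk\<close> reverse the order of the valuations.\<close>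

lemma residue_card_gt_one: "1 < residue_card v"
proof -
  define R where "R = {(x, y). x \<in> int_ring v \<and> y \<in> int_ring v \<and> x - y \<in> max_ideal v}"
  have "(1, 1) \<in> R" "(0, 1) \<notin> R" by (auto simp: R_def int_ring_def max_ideal_def)
  then have "R `` {0} \<noteq> R `` {1}" by blast
  moreover have sub: "{R `` {0}, R `` {1}} \<subseteq> residue_field v"
  proof -
    have "0 \<in> int_ring v" "1 \<in> int_ring v" by (auto simp: int_ring_def)
    then show ?thesis unfolding residue_field_def R_def[symmetric] by (auto intro: quotientI)
  qed
  ultimately have "2 = card {R `` {0}, R `` {1}}" by simp
  also have "\<dots> \<le> residue_card v" unfolding residue_card_def by (intro card_mono finite_residue sub)
  finally show ?thesis by simp
qed

lemma absk_le_iff: "absk v x \<le> absk v y \<longleftrightarrow> x = 0 \<or> (y \<noteq> 0 \<and> v y \<le> v x)"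
  using residue_card_gt_one by (auto simp: absk_def not_le)

lemma absk_le_one_iff: "absk v x \<le> 1 \<longleftrightarrow> vge v 0 x"
proof -
  have "absk v 1 = 1" using residue_card_gt_one by (simp add: absk_def)
  then show ?thesis using absk_le_iff[of x 1] by (simp add: vge_def)
qed

end

section \<open>The norm group of a quadratic extension\<close>

text \<open>For nonsquare \<open>d\<close> this is the group of norms from \<open>k(sqrt d)\<close>;
  the explicit norm form avoids constructing the extension.\<close>

definition nrm :: "'k::field \<Rightarrow> 'k set" where
  "nrm d = {x. x \<noteq> 0 \<and> (\<exists>a b. x = a * a - d * b * b)}"

lemma nrm_nonzero: "x \<in> nrm d \<Longrightarrow> x \<noteq> 0"
  by (simp add: nrm_def)

lemma nrm_mult: "x \<in> nrm d \<Longrightarrow> y \<in> nrm d \<Longrightarrow> x * y \<in> nrm d"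
proof -
  assume "x \<in> nrm d" "y \<in> nrm d"
  then obtain a b a' b' where *: "x * y \<noteq> 0" "x = a * a - d * b * b" "y = a' * a' - d * b' * b'"
    by (auto simp: nrm_def)
  have "x * y = (a * a' + d * b * b') * (a * a' + d * b * b') - d * (a * b' + a' * b) * (a * b' + a' * b)"
    unfolding * by algebra
  then show ?thesis using * unfolding nrm_def by blast
qed

lemma nrm_square: "c \<noteq> 0 \<Longrightarrow> c * c \<in> nrm d"
  unfolding nrm_def by (intro CollectI conjI exI[of _ c] exI[of _ 0]) auto

lemma nrm_one: "1 \<in> nrm d"
  using nrm_square[of 1] by simp

lemma nrm_mult_square_iff: "c \<noteq> 0 \<Longrightarrow> x * (c * c) \<in> nrm d \<longleftrightarrow> x \<in> nrm d"
  using nrm_mult[OF _ nrm_square, of x d c] nrm_mult[OF _ nrm_square, of "x * (c * c)" d "inverse c"]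
  by (auto simp: field_simps)

lemma nrm_inverse: "x \<in> nrm d \<Longrightarrow> inverse x \<in> nrm d"
  using nrm_mult_square_iff[of x "inverse x" d] nrm_nonzero[of x d] by (simp add: field_simps)

lemma nrm_mult_left_iff: "x \<in> nrm d \<Longrightarrow> x * y \<in> nrm d \<longleftrightarrow> y \<in> nrm d"
  using nrm_mult[of x d y] nrm_mult[OF nrm_inverse, of x d "x * y"] nrm_nonzero[of x d]
  by (auto simp: field_simps)

lemma nrm_scale:
  assumes "c \<noteq> 0"
  shows "nrm (d * (c * c)) = nrm d"
proof -
  have "(\<exists>a b. x = a * a - d * (c * c) * b * b) \<longleftrightarrow> (\<exists>a b. x = a * a - d * b * b)" for x
  proof
    assume "\<exists>a b. x = a * a - d * (c * c) * b * b"
    then obtain a b where "x = a * a - d * (c * b) * (c * b)" by (auto simp: mult_ac)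
    then show "\<exists>a b. x = a * a - d * b * b" by blast
  next
    assume "\<exists>a b. x = a * a - d * b * b"
    then obtain a b where "x = a * a - d * b * b" by blast
    then have "x = a * a - d * (c * c) * (b / c) * (b / c)" using assms by (simp add: mult_ac)
    then show "\<exists>a b. x = a * a - d * (c * c) * b * b" by blast
  qed
  then show ?thesis by (simp add: nrm_def)
qed

context dyadic
begin

section \<open>Squares and the filtration of the unit group\<close>

lemma v_surj: "\<exists>x. x \<noteq> 0 \<and> v x = n"
  using dyadic unfolding dyadic_local_field_def discrete_valuation_def by blast

text \<open>The square of \<open>1 + 2 * y\<close> is \<open>1 + 4 * (y + y * y)\<close>, and
  Hensel's lemma solves \<open>y + y * y = x\<close>.\<close>

lemma local_square:
  assumes "vge v 1 x"
  shows "\<exists>c. c \<noteq> 0 \<and> 1 + 4 * x = c * c"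
proof -
  obtain y where y: "vge v 1 y" "y + 1 * y * y = x"
    using hensel_solve[of x 1] assms by auto
  have "1 + 2 * y \<noteq> 0"
    by (rule unit_plus_small) (use vge_mult0[OF two_small vge_mono[OF y(1)]] in auto)
  moreover have "1 + 4 * x = (1 + 2 * y) * (1 + 2 * y)"
    unfolding y(2)[symmetric] by (simp add: algebra_simps)
  ultimately show ?thesis by blast
qed

lemma vge_div_unit: "vge v M x \<Longrightarrow> u \<noteq> 0 \<Longrightarrow> v u = 0 \<Longrightarrow> vge v M (x / u)"
  using vge_divide[of M x u] by simp

lemma unit_square_approx:
  assumes "u \<noteq> 0" "v u = 0"
  shows "\<exists>w. w \<noteq> 0 \<and> v w = 0 \<and> vge v 1 (u - w * w)"
proof -
  obtain w where w: "vge v 0 w" "cong1 (w * w) u"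
    using residue_sqrt[of u] assms by (auto simp: vge_def)
  have d: "vge v 1 (u - w * w)" using cong1_sym[OF w(2)] by (simp add: cong1_def)
  have "\<not> vge v 1 w"
  proof
    assume "vge v 1 w"
    then have "vge v 1 (u - w * w + w * w)" by (intro vge_add d vge_mult0 w)
    then show False using assms by (simp add: vge_def)
  qed
  then show ?thesis using d w(1) by (auto simp: vge_def)
qed

lemma even_val_unit:
  assumes "x \<noteq> 0" "even (v x)"
  shows "\<exists>c. c \<noteq> 0 \<and> v (x * (c * c)) = 0"
proof -
  obtain c where "c \<noteq> 0" "v c = - (v x div 2)" using v_surj by blast
  then show ?thesis using assms by (intro exI[of _ c]) (auto simp: v_mult)
qed

lemma unit_principal:
  assumes "u \<noteq> 0" "v u = 0"
  shows "\<exists>c. c \<noteq> 0 \<and> vge v 1 (u * (c * c) - 1)"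
proof -
  obtain w where w: "w \<noteq> 0" "v w = 0" "vge v 1 (u - w * w)"
    using unit_square_approx[OF assms] by blast
  have "vge v 1 ((u - w * w) / (w * w))"
    using w by (intro vge_div_unit) (auto simp: v_mult)
  moreover have "(u - w * w) / (w * w) = u * (inverse w * inverse w) - 1"
    using w by (simp add: field_simps)
  ultimately show ?thesis using w by (intro exI[of _ "inverse w"]) auto
qed

text \<open>A subgroup of the multiplicative group containing the squares has index at most 2 if it
  meets every level of the filtration \<open>1 + \<pp>\<^sup>i\<close> below \<open>v \<gamma>\<close> fully, the level
  \<open>v \<gamma>\<close> in the Artin--Schreier image, and contains everything above.\<close>
lemma filtration_index_two:
  assumes nz: "\<And>x. x \<in> S \<Longrightarrow> x \<noteq> 0"
    and mul: "\<And>x y. x \<in> S \<Longrightarrow> y \<in> S \<Longrightarrow> x * y \<in> S"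
    and squares: "\<And>c. c \<noteq> 0 \<Longrightarrow> c * c \<in> S"
    and \<gamma>: "\<gamma> \<noteq> 0" "1 \<le> v \<gamma>"
    and above: "\<And>\<epsilon>. vge v (v \<gamma> + 1) \<epsilon> \<Longrightarrow> 1 + \<epsilon> \<in> S"
    and at: "\<And>y. vge v 0 y \<Longrightarrow> 1 + \<gamma> * (y + y * y) \<in> S"
    and below: "\<And>\<epsilon>. \<epsilon> \<noteq> 0 \<Longrightarrow> 1 \<le> v \<epsilon> \<Longrightarrow> v \<epsilon> < v \<gamma> \<Longrightarrow>
                  \<exists>\<epsilon>'. vge v (v \<epsilon> + 1) (\<epsilon> - \<epsilon>') \<and> 1 + \<epsilon>' \<in> S"
    and odd_val: "\<exists>x \<in> S. odd (v x)"
    and xy: "x \<noteq> 0" "y \<noteq> 0"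
  shows "x \<in> S \<or> y \<in> S \<or> x * y \<in> S"
proof -
  have inv: "inverse s \<in> S" if "s \<in> S" for s
    using mul[OF that squares[of "inverse s"]] nz[OF that] by (simp add: field_simps)
  have cancel: "x \<in> S" if "x * s \<in> S" "s \<in> S" for x s
    using mul[OF that(1) inv[OF that(2)]] nz[OF that(2)] by (simp add: field_simps)
  have red1: "\<exists>s \<in> S. vge v 1 (x * s - 1)" if "x \<noteq> 0" for x
  proof -
    obtain s where s: "s \<in> S" "even (v (x * s))"
    proof (cases "even (v x)")
      case True
      then show ?thesis using that squares[of 1] by simp
    next
      case False
      obtain s where "s \<in> S" "odd (v s)" using odd_val by blast
      then show ?thesis using that[of s] False \<open>x \<noteq> 0\<close> nz by (auto simp: v_mult)
    qed
    have xs: "x * s \<noteq> 0" using s nz \<open>x \<noteq> 0\<close> by auto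
    obtain c where c: "c \<noteq> 0" "v (x * s * (c * c)) = 0" using even_val_unit[OF xs s(2)] by blast
    obtain c' where c': "c' \<noteq> 0" "vge v 1 (x * s * (c * c) * (c' * c') - 1)"
      using unit_principal[of "x * s * (c * c)"] c xs by auto
    have "s * (c * c) * (c' * c') \<in> S" using s c c' mul squares by blast
    then show ?thesis using c'(2) by (intro bexI[of _ "s * (c * c) * (c' * c')"]) (simp_all add: mult.assoc)
  qed
  \<comment> \<open>Below the critical level, dividing by \<open>1 + \<epsilon>'\<close> removes the
    leading term of \<open>\<epsilon>\<close>, so \<open>x * s\<close> approaches 1 one level at a
    time.\<close>
  have red: "\<exists>s \<in> S. vge v (int i + 1) (x * s - 1)" if "x \<noteq> 0" "int i + 1 \<le> v \<gamma>" for x i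
    using that(2)
  proof (induction i)
    case 0
    then show ?case using red1[OF that(1)] by simp
  next
    case (Suc i)
    then obtain s where s: "s \<in> S" "vge v (int i + 1) (x * s - 1)" by auto
    define \<epsilon> where "\<epsilon> = x * s - 1"
    show ?case
    proof (cases "vge v (int i + 2) \<epsilon>")
      case True
      then show ?thesis using s by (intro bexI[of _ s]) (auto simp: \<epsilon>_def algebra_simps)
    next
      case False
      then have e: "\<epsilon> \<noteq> 0" "v \<epsilon> = int i + 1" using s(2) by (auto simp: vge_def \<epsilon>_def)
      obtain \<epsilon>' where e': "vge v (v \<epsilon> + 1) (\<epsilon> - \<epsilon>')" "1 + \<epsilon>' \<in> S"
        using below[of \<epsilon>] e Suc.prems by auto
      have "vge v 1 (\<epsilon> - (\<epsilon> - \<epsilon>'))"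
        using e by (intro vge_diff vge_mono[OF e'(1)]) (auto simp: vge_def)
      then have u: "1 + \<epsilon>' \<noteq> 0" "v (1 + \<epsilon>') = 0" using unit_plus_small[of 1 \<epsilon>'] by auto
      have "x * (s * inverse (1 + \<epsilon>')) - 1 = (\<epsilon> - \<epsilon>') / (1 + \<epsilon>')"
        using u(1) by (simp add: \<epsilon>_def divide_simps)
      moreover have "vge v (v \<epsilon> + 1) ((\<epsilon> - \<epsilon>') / (1 + \<epsilon>'))" by (rule vge_div_unit[OF e'(1) u])
      ultimately show ?thesis using mul[OF s(1) inv[OF e'(2)]] e(2)
        by (intro bexI[of _ "s * inverse (1 + \<epsilon>')"]) (auto simp: algebra_simps)
    qed
  qed
  have red': "\<exists>s \<in> S. \<exists>a. vge v 0 a \<and> x * s = 1 + \<gamma> * a" if xn: "x \<noteq> 0" for x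
  proof -
    obtain s where s: "s \<in> S" "vge v (v \<gamma>) (x * s - 1)"
      using red[OF xn, of "nat (v \<gamma> - 1)"] \<gamma> by auto
    have "vge v 0 ((x * s - 1) / \<gamma>)" using vge_divide[OF s(2) \<gamma>(1)] by simp
    moreover have "x * s = 1 + \<gamma> * ((x * s - 1) / \<gamma>)" using \<gamma> by simp
    ultimately show ?thesis using s by blast
  qed
  have clear_den: "(1 + x / u) * u = u + x" if "u \<noteq> 0" for x u :: 'k
    using that by (simp add: field_simps)
  \<comment> \<open>At the critical level only the residue class of \<open>c\<close> matters:
    \<open>1 + \<gamma> * (t + t * t)\<close> lies in \<open>S\<close>, and the remaining factor is
    1 plus a term beyond \<open>v \<gamma>\<close>.\<close>
  have fin: "1 + \<gamma> * c + \<delta> \<in> S"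
    if t: "vge v 0 t" "cong1 (t + t * t) c" and \<delta>: "vge v (v \<gamma> + 1) \<delta>" for t c \<delta>
  proof -
    have "vge v (v \<gamma>) (\<gamma> * (t + t * t))"
      using t by (intro vge_mult0 vge_add) (auto simp: vge_def[of v _ \<gamma>])
    then have u: "1 + \<gamma> * (t + t * t) \<noteq> 0" "v (1 + \<gamma> * (t + t * t)) = 0"
      using unit_plus_small[of 1 "\<gamma> * (t + t * t)"] vge_mono \<gamma> by auto
    have "vge v (v \<gamma> + 1) (\<gamma> * (c - (t + t * t)))"
      using cong1_sym[OF t(2)] by (intro vge_mult) (auto simp: vge_def[of v _ \<gamma>] cong1_def)
    then have "vge v (v \<gamma> + 1) ((\<gamma> * (c - (t + t * t)) + \<delta>) / (1 + \<gamma> * (t + t * t)))"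
      by (intro vge_div_unit vge_add \<delta> u)
    from mul[OF above[OF this] at[OF t(1)]]
    have "1 + \<gamma> * (t + t * t) + (\<gamma> * (c - (t + t * t)) + \<delta>) \<in> S"
      by (simp only: clear_den[OF u(1)])
    then show ?thesis by (simp add: right_diff_distrib add.assoc)
  qed
  obtain s a where s: "s \<in> S" "vge v 0 a" "x * s = 1 + \<gamma> * a" using red'[OF xy(1)] by blast
  obtain s' b where s': "s' \<in> S" "vge v 0 b" "y * s' = 1 + \<gamma> * b" using red'[OF xy(2)] by blast
  obtain t where t: "vge v 0 t"
    "cong1 (t + t * t) a \<or> cong1 (t + t * t) b \<or> cong1 (t + t * t) (a + b)"
    using residue_artin_schreier[OF s(2) s'(2)] by blast
  from t(2) consider "cong1 (t + t * t) a" | "cong1 (t + t * t) b" | "cong1 (t + t * t) (a + b)" by blast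
  then show ?thesis
  proof cases
    case 1
    then show ?thesis using fin[OF t(1) 1 vge_zero] cancel[of x s] s by simp
  next
    case 2
    then show ?thesis using fin[OF t(1) 2 vge_zero] cancel[of y s'] s' by simp
  next
    case 3
    \<comment> \<open>The cross term of the product lies beyond the critical level because
      \<open>1 \<le> v \<gamma>\<close>, so the coefficients \<open>a\<close> and \<open>b\<close>
      add.\<close>
    have "vge v (v \<gamma> + 1) (\<gamma> * \<gamma> * (a * b))"
      using s s' \<gamma> by (intro vge_mult0 vge_mult) (auto simp: vge_def[of v _ \<gamma>])
    from fin[OF t(1) 3 this] have "(1 + \<gamma> * a) * (1 + \<gamma> * b) \<in> S" by (simp add: algebra_simps)
    then have "x * y * (s * s') \<in> S"
      unfolding s(3)[symmetric] s'(3)[symmetric] by (simp add: mult_ac)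
    then show ?thesis using cancel mul s(1) s'(1) by blast
  qed
qed

text \<open>The quotient \<open>\<epsilon> / (p * (c * c))\<close> is a unit, and units are squares
  to first order because squaring is onto in the residue field.\<close>

lemma sqrt_approx:
  assumes "\<epsilon> \<noteq> 0" "p \<noteq> 0" "v \<epsilon> = v p + 2 * j"
  shows "\<exists>w. vge v j w \<and> vge v (v \<epsilon> + 1) (\<epsilon> - p * w * w)"
proof -
  obtain c where c: "c \<noteq> 0" "v c = j" using v_surj by blast
  define u where "u = \<epsilon> / (p * (c * c))"
  have u: "u \<noteq> 0" "v u = 0" using assms c by (auto simp: u_def v_divide v_mult)
  obtain w where w: "w \<noteq> 0" "v w = 0" "vge v 1 (u - w * w)" using unit_square_approx[OF u] by blast
  have "vge v (v \<epsilon> + 1) (p * (c * c) * (u - w * w))"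
    using c assms by (intro vge_mult w(3)) (simp add: vge_def v_mult)
  moreover have "p * (c * c) * (u - w * w) = \<epsilon> - p * (c * w) * (c * w)"
    using c assms by (simp add: u_def right_diff_distrib)
  ultimately show ?thesis using w c by (intro exI[of _ "c * w"]) (simp add: vge_def v_mult)
qed

text \<open>\<open>2 * w + w * w\<close> is the deviation of the square of \<open>1 + w\<close> from
  1. For \<open>j < v 2\<close> the term \<open>2 * w\<close> is of higher order, so a square root
  of the leading term is enough.\<close>

lemma square_approx_even:
  assumes "\<epsilon> \<noteq> 0" "v \<epsilon> = 2 * j" "1 \<le> j" "j < v 2"
  shows "\<exists>w. vge v j w \<and> vge v (v \<epsilon> + 1) (\<epsilon> - (2 * w + w * w))"
proof -
  obtain w where w: "vge v j w" "vge v (v \<epsilon> + 1) (\<epsilon> - 1 * w * w)"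
    using sqrt_approx[of \<epsilon> 1 j] assms by auto
  have "vge v (v 2 + j) (2 * w)" by (intro vge_mult w) (simp add: vge_def)
  then have "vge v (v \<epsilon> + 1) (\<epsilon> - 1 * w * w - 2 * w)"
    using assms by (intro vge_diff w(2)) (auto elim: vge_mono)
  then show ?thesis using w by (intro exI[of _ w]) (simp add: algebra_simps)
qed

section \<open>The norm group of \<open>k(sqrt d)\<close>, by the type of \<open>d\<close>\<close>

lemma v_four: "v 4 = 2 * v 2"
  using v_mult[of 2 2] by simp

lemma vge_one_nonneg: "vge v 1 x \<Longrightarrow> vge v 0 x"
  by (erule vge_mono) simp

lemma nrm_below_even:
  assumes "\<epsilon> \<noteq> 0" "v \<epsilon> = 2 * j" "1 \<le> j" "j < v 2"
  shows "\<exists>\<epsilon>'. vge v (v \<epsilon> + 1) (\<epsilon> - \<epsilon>') \<and> 1 + \<epsilon>' \<in> nrm d"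
proof -
  obtain w where w: "vge v j w" "vge v (v \<epsilon> + 1) (\<epsilon> - (2 * w + w * w))"
    using square_approx_even[OF assms] by blast
  have "1 + w \<noteq> 0" using unit_plus_small[of 1 w] vge_mono[OF w(1) assms(3)] by auto
  from nrm_square[OF this, of d] have "1 + (2 * w + w * w) \<in> nrm d" by (simp add: algebra_simps)
  with w(2) show ?thesis by blast
qed

text \<open>The critical level is \<open>v 4\<close>, where squares give the Artin-Schreier image.
  Below it, squares cover the even levels and norms \<open>1 - d * w * w\<close> the odd ones;
  \<open>- d\<close> is a norm of odd valuation.\<close>

lemma nrm_index_prime:
  assumes d: "d \<noteq> 0" "v d = 1" and xy: "x \<noteq> 0" "y \<noteq> 0"
  shows "x \<in> nrm d \<or> y \<in> nrm d \<or> x * y \<in> nrm d"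
proof (rule filtration_index_two[OF nrm_nonzero nrm_mult nrm_square, where \<gamma> = 4])
  fix \<epsilon> assume *: "vge v (v 4 + 1) \<epsilon>"
  have "vge v 1 (\<epsilon> / 4)" using vge_divide[OF *, of 4] by simp
  from local_square[OF this] show "1 + \<epsilon> \<in> nrm d" using nrm_square[of _ d] by auto
next
  fix y assume y: "vge v 0 y"
  have "1 + 2 * y \<noteq> 0" using unit_plus_small[of 1 "2 * y"] vge_mult0[OF two_small y] by auto
  from nrm_square[OF this, of d] show "1 + 4 * (y + y * y) \<in> nrm d" by (simp add: algebra_simps)
next
  fix \<epsilon> assume e: "\<epsilon> \<noteq> 0" "1 \<le> v \<epsilon>" "v \<epsilon> < v 4"
  show "\<exists>\<epsilon>'. vge v (v \<epsilon> + 1) (\<epsilon> - \<epsilon>') \<and> 1 + \<epsilon>' \<in> nrm d"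
  proof (cases "even (v \<epsilon>)")
    case True
    then obtain j where "v \<epsilon> = 2 * j" by blast
    then show ?thesis using nrm_below_even e v_four by auto
  next
    case False
    then obtain j where j: "v \<epsilon> = 2 * j + 1" by (elim oddE)
    obtain w where w: "vge v j w" "vge v (v \<epsilon> + 1) (\<epsilon> - (- d) * w * w)"
      using sqrt_approx[of \<epsilon> "- d" j] e d j by auto
    have j0: "0 \<le> j" using j e by simp
    have "vge v (1 + (j + j)) (- d * (w * w))" using d w by (intro vge_mult) (auto simp: vge_def)
    then have "vge v 1 (- d * (w * w))" by (rule vge_mono) (use j0 in simp)
    then have "1 + - d * (w * w) \<noteq> 0" by (rule unit_plus_small[of 1, rotated 2]) simp_all
    moreover have "1 + - d * (w * w) = 1 * 1 - d * w * w" by (simp add: algebra_simps)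
    ultimately have "1 + - d * (w * w) \<in> nrm d" unfolding nrm_def by blast
    then show ?thesis using w(2) by (intro exI[of _ "- d * (w * w)"]) (simp add: mult.assoc)
  qed
next
  have "0 * 0 - d * 1 * 1 \<noteq> 0" using d by simp
  then have "0 * 0 - d * 1 * 1 \<in> nrm d" unfolding nrm_def by blast
  then have "- d \<in> nrm d" by simp
  then show "\<exists>x\<in>nrm d. odd (v x)" using d by (intro bexI) auto
qed (use v_four v_two xy in auto)

text \<open>The element \<open>(sqrt d - 1) / c\<close> is a uniformizer of the extension; its trace
  \<open>T\<close> and norm \<open>P\<close> give the norm form
  \<open>a * a + T * a * b + P * b * b\<close>. For \<open>a = 1\<close> the two terms in
  \<open>b\<close> balance at \<open>b = T / P * y\<close>, which puts the critical level at
  \<open>T * T / P\<close>.\<close>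

lemma nrm_index_ramified_unit:
  assumes d: "d = 1 + \<delta>" "\<delta> \<noteq> 0" "odd (v \<delta>)" "1 \<le> v \<delta>" "v \<delta> < v 4" and xy: "x \<noteq> 0" "y \<noteq> 0"
  shows "x \<in> nrm d \<or> y \<in> nrm d \<or> x * y \<in> nrm d"
proof -
  obtain m where m: "v \<delta> = 2 * m + 1" using d(3) by (elim oddE)
  obtain c where c: "c \<noteq> 0" "v c = m" using v_surj by blast
  define T P where "T = - 2 / c" and "P = - \<delta> / (c * c)"
  have T: "T \<noteq> 0" "v T = v 2 - m" and P: "P \<noteq> 0" "v P = 1"
    using c d m v_neg[of "2 / c"] v_neg[of "\<delta> / (c * c)"] by (auto simp: T_def P_def v_divide v_mult)
  have s1: "1 \<le> v T" using T d(5) v_four m by auto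
  have sub: "a * a + T * a * b + P * b * b \<in> nrm d" if "a * a + T * a * b + P * b * b \<noteq> 0" for a b
  proof -
    have "a * a + T * a * b + P * b * b = (a - b / c) * (a - b / c) - d * (b / c) * (b / c)"
      using c by (simp add: T_def P_def d(1) divide_simps) (simp add: algebra_simps)
    then show ?thesis using that unfolding nrm_def by blast
  qed
  have sub1: "1 + (T * b + P * b * b) \<in> nrm d" if "vge v 1 (T * b + P * b * b)" for b
    using sub[of 1 b] unit_plus_small[OF _ _ that, of 1] by (simp add: add.assoc)
  show ?thesis
  proof (rule filtration_index_two[OF nrm_nonzero nrm_mult nrm_square, where \<gamma> = "T * T / P"])
    show g0: "T * T / P \<noteq> 0" using T P by simp
    have vg: "v (T * T / P) = 2 * v T - 1" using T P by (simp add: v_divide v_mult)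
    show g1: "1 \<le> v (T * T / P)" using vg s1 by simp
    show "1 + \<epsilon> \<in> nrm d" if e: "vge v (v (T * T / P) + 1) \<epsilon>" for \<epsilon>
    proof -
      have e': "vge v (2 * v T) \<epsilon>" using e vg by simp
      have "vge v (v T) (\<epsilon> / T)" using vge_divide[OF e' T(1)] by simp
      moreover have "vge v (1 - v T) (P / T)" using P T by (simp add: vge_def v_divide)
      ultimately have "vge v 1 ((\<epsilon> / T) * (P / T))" using vge_mult by fastforce
      from hensel_solve[OF this] obtain b where b: "b + P / T * b * b = \<epsilon> / T" by blast
      have "T * b + P * b * b = T * (b + P / T * b * b)" using T by (simp add: distrib_left)
      then have "T * b + P * b * b = \<epsilon>" using b T by simp
      then show ?thesis using sub1[of b] vge_mono[OF e'] s1 by auto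
    qed
    show "1 + T * T / P * (y + y * y) \<in> nrm d" if y: "vge v 0 y" for y
    proof -
      have eq: "T * (T / P * y) + P * (T / P * y) * (T / P * y) = T * T / P * (y + y * y)"
        using P by (simp add: divide_simps) (simp add: algebra_simps)
      have "vge v 1 (T * T / P * (y + y * y))"
        using y g1 by (intro vge_mult0 vge_add) (auto simp: vge_def[of v _ "_ / _"])
      then show ?thesis using sub1[of "T / P * y"] eq by simp
    qed
    show "\<exists>\<epsilon>'. vge v (v \<epsilon> + 1) (\<epsilon> - \<epsilon>') \<and> 1 + \<epsilon>' \<in> nrm d"
      if e: "\<epsilon> \<noteq> 0" "1 \<le> v \<epsilon>" "v \<epsilon> < v (T * T / P)" for \<epsilon>
    proof (cases "even (v \<epsilon>)")
      case True
      then obtain j where "v \<epsilon> = 2 * j" by blast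
      moreover have "0 \<le> m" using m d(4) by simp
      ultimately show ?thesis using nrm_below_even[of \<epsilon> j] e vg T(2) by auto
    next
      case False
      then obtain j where j: "v \<epsilon> = 2 * j + 1" by (elim oddE)
      obtain w where w: "vge v j w" "vge v (v \<epsilon> + 1) (\<epsilon> - P * w * w)"
        using sqrt_approx[of \<epsilon> P j] e P j by auto
      have "vge v (v T + j) (T * w)" by (intro vge_mult w(1)) (simp add: vge_def)
      then have Tw: "vge v (v \<epsilon> + 1) (T * w)" using j e(3) vg by (auto elim: vge_mono)
      have diff: "vge v (v \<epsilon> + 1) (\<epsilon> - (T * w + P * w * w))"
        using vge_diff[OF w(2) Tw] by (simp add: algebra_simps)
      have "vge v 1 (\<epsilon> - (\<epsilon> - (T * w + P * w * w)))"
        using e by (intro vge_diff vge_mono[OF diff]) (auto simp: vge_def)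
      then show ?thesis using diff sub1[of w] by auto
    qed
    have "P \<in> nrm d" using sub[of 0 1] P by simp
    then show "\<exists>x\<in>nrm d. odd (v x)" using P by (intro bexI) auto
  qed (use xy in auto)
qed

text \<open>Every unit is a norm: starting from a first-order square root \<open>w\<close> of
  \<open>u\<close>, Hensel's lemma solves \<open>w * w + w * b - \<rho> * b * b = u\<close> for
  \<open>b\<close>. So all elements of even valuation are norms, and one of \<open>x\<close>,
  \<open>y\<close>, \<open>x * y\<close> has even valuation.\<close>

lemma nrm_index_unramified:
  assumes d: "d = 1 + 4 * \<rho>" "vge v 0 \<rho>" and xy: "x \<noteq> 0" "y \<noteq> 0"
  shows "x \<in> nrm d \<or> y \<in> nrm d \<or> x * y \<in> nrm d"
proof -
  have unit: "u \<in> nrm d" if u: "u \<noteq> 0" "v u = 0" for u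
  proof -
    obtain w where w: "w \<noteq> 0" "v w = 0" "vge v 1 (u - w * w)" using unit_square_approx[OF u] by blast
    have "vge v 1 ((u - w * w) / w * (- \<rho> / w))"
      using d(2) w by (intro vge_mult0 vge_div_unit) auto
    from hensel_solve[OF this] obtain b where b: "b + - \<rho> / w * b * b = (u - w * w) / w" by blast
    have "w * (b + - \<rho> / w * b * b) = u - w * w" unfolding b using w by simp
    then have "u = w * w + w * b - \<rho> * b * b" using w by (simp add: algebra_simps)
    also have "\<dots> = (w + b / 2) * (w + b / 2) - d * (b / 2) * (b / 2)"
      by (simp add: d(1) algebra_simps)
    finally show ?thesis using u unfolding nrm_def by blast
  qed
  have even: "x \<in> nrm d" if x: "x \<noteq> 0" "even (v x)" for x
  proof -
    obtain c where c: "c \<noteq> 0" "v (x * (c * c)) = 0" using even_val_unit[OF x] by blast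
    then show ?thesis using unit[of "x * (c * c)"] x nrm_mult_square_iff[of c x d] by auto
  qed
  show ?thesis using even[of x] even[of y] even[of "x * y"] xy by (auto simp: v_mult)
qed

text \<open>An odd valuation can be scaled to 1. For units this is the quadratic defect: a deviation
  from 1 of even valuation below \<open>v 4\<close> is pushed up by a square factor, so the process
  stops only at an odd valuation or on reaching \<open>v 4\<close>.\<close>

lemma square_class_normal_form:
  assumes d: "d \<noteq> 0"
  shows "\<exists>c. c \<noteq> 0 \<and> (v (d * (c * c)) = 1 \<or>
     (\<exists>\<delta>. d * (c * c) = 1 + \<delta> \<and> \<delta> \<noteq> 0 \<and> odd (v \<delta>) \<and> 1 \<le> v \<delta> \<and> v \<delta> < v 4) \<or>
     (\<exists>\<rho>. d * (c * c) = 1 + 4 * \<rho> \<and> vge v 0 \<rho>))"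
proof (cases "even (v d)")
  case False
  then obtain n where n: "v d = 2 * n + 1" by (elim oddE)
  obtain c where "c \<noteq> 0" "v c = - n" using v_surj by blast
  then show ?thesis using n d by (intro exI[of _ c]) (simp add: v_mult)
next
  case True
  obtain c where c: "c \<noteq> 0" "v (d * (c * c)) = 0" using even_val_unit[OF d True] by blast
  obtain c' where c': "c' \<noteq> 0" "vge v 1 (d * (c * c) * (c' * c') - 1)"
    using unit_principal[of "d * (c * c)"] c d by auto
  have "\<exists>c. c \<noteq> 0 \<and> (vge v (int i + 1) (d * (c * c) - 1) \<or>
     (\<exists>\<delta>. d * (c * c) = 1 + \<delta> \<and> \<delta> \<noteq> 0 \<and> odd (v \<delta>) \<and> 1 \<le> v \<delta> \<and> v \<delta> < v 4))"
    if "int i + 1 \<le> v 4" for i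
    using that
  proof (induction i)
    case 0
    have "vge v 1 (d * ((c * c') * (c * c')) - 1)" using c'(2) by (simp add: mult_ac)
    then show ?case using c c' by (intro exI[of _ "c * c'"]) simp
  next
    case (Suc i)
    then have lt: "int i + 1 < v 4" by simp
    from Suc obtain c where c: "c \<noteq> 0" and alt: "vge v (int i + 1) (d * (c * c) - 1) \<or>
     (\<exists>\<delta>. d * (c * c) = 1 + \<delta> \<and> \<delta> \<noteq> 0 \<and> odd (v \<delta>) \<and> 1 \<le> v \<delta> \<and> v \<delta> < v 4)" by auto
    define \<delta> where "\<delta> = d * (c * c) - 1"
    have dc: "d * (c * c) = 1 + \<delta>" by (simp add: \<delta>_def)
    consider "\<exists>\<delta>. d * (c * c) = 1 + \<delta> \<and> \<delta> \<noteq> 0 \<and> odd (v \<delta>) \<and> 1 \<le> v \<delta> \<and> v \<delta> < v 4"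
      | "vge v (int i + 2) \<delta>" | "\<delta> \<noteq> 0" "v \<delta> = int i + 1" "even (v \<delta>)"
    proof (cases "vge v (int i + 2) \<delta>")
      case False
      assume a1: "\<exists>\<delta>. d * (c * c) = 1 + \<delta> \<and> \<delta> \<noteq> 0 \<and> odd (v \<delta>) \<and> 1 \<le> v \<delta> \<and> v \<delta> < v 4 \<Longrightarrow> thesis"
        and a3: "\<delta> \<noteq> 0 \<Longrightarrow> v \<delta> = int i + 1 \<Longrightarrow> even (v \<delta>) \<Longrightarrow> thesis"
      show thesis
      proof (cases "vge v (int i + 1) \<delta>")
        case True
        then have "\<delta> \<noteq> 0" "v \<delta> = int i + 1" using False by (auto simp: vge_def)
        then show ?thesis using a1 a3 dc lt by (cases "even (v \<delta>)") auto
      next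
        case False
        then show ?thesis using alt a1 unfolding \<delta>_def by blast
      qed
    qed
    then show ?case
    proof cases
      case 1
      then show ?thesis using c by blast
    next
      case 2
      then show ?thesis using c by (intro exI[of _ c]) (auto simp: \<delta>_def algebra_simps)
    next
      case 3
      obtain j where j: "v \<delta> = 2 * j" using 3(3) by blast
      have j1: "1 \<le> j" "j < v 2" using j 3 lt v_four by auto
      obtain w where w: "vge v j w" "vge v (v \<delta> + 1) (\<delta> - (2 * w + w * w))"
        using square_approx_even[OF 3(1) j j1] by blast
      have u: "1 + w \<noteq> 0" "v (1 + w) = 0"
        using unit_plus_small[of 1 w] vge_mono[OF w(1) j1(1)] by auto
      have "vge v (v \<delta> + 1) ((\<delta> - (2 * w + w * w)) / ((1 + w) * (1 + w)))"
        by (intro vge_div_unit w(2)) (use u in \<open>simp_all add: v_mult\<close>)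
      moreover have "(\<delta> - (2 * w + w * w)) / ((1 + w) * (1 + w)) = d * ((c / (1 + w)) * (c / (1 + w))) - 1"
      proof -
        have "d * ((c / (1 + w)) * (c / (1 + w))) = (1 + \<delta>) / ((1 + w) * (1 + w))"
          unfolding dc[symmetric] by simp
        then show ?thesis using u(1) by (simp add: divide_simps) (simp add: algebra_simps)
      qed
      ultimately have "vge v (int (Suc i) + 1) (d * ((c / (1 + w)) * (c / (1 + w))) - 1)"
        using 3(2) by (simp add: add_ac)
      then show ?thesis using c u by (intro exI[of _ "c / (1 + w)"]) simp
    qed
  qed
  from this[of "nat (v 4 - 1)"] obtain c where c: "c \<noteq> 0" "vge v (v 4) (d * (c * c) - 1) \<or>
     (\<exists>\<delta>. d * (c * c) = 1 + \<delta> \<and> \<delta> \<noteq> 0 \<and> odd (v \<delta>) \<and> 1 \<le> v \<delta> \<and> v \<delta> < v 4)"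
    using v_four v_two by auto
  show ?thesis
  proof (cases "vge v (v 4) (d * (c * c) - 1)")
    case True
    have "d * (c * c) = 1 + 4 * ((d * (c * c) - 1) / 4)" by (simp add: field_simps)
    then show ?thesis using vge_divide[OF True, of 4] c(1) by (intro exI[of _ c]) auto
  qed (use c in blast)
qed

text \<open>This is what is needed of local class field theory: norm groups have index at most 2.
  That the index is not 1 in the case at hand is supplied by the division algebra, in
  \<open>anticommuting_nonnorm\<close>.\<close>

theorem nrm_index_two:
  fixes d :: 'k
  assumes d: "d \<noteq> 0" and xy: "x \<noteq> 0" "y \<noteq> 0"
  shows "x \<in> nrm d \<or> y \<in> nrm d \<or> x * y \<in> nrm d"
proof -
  obtain c where c: "c \<noteq> 0" and nf: "v (d * (c * c)) = 1 \<or>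
     (\<exists>\<delta>. d * (c * c) = 1 + \<delta> \<and> \<delta> \<noteq> 0 \<and> odd (v \<delta>) \<and> 1 \<le> v \<delta> \<and> v \<delta> < v 4) \<or>
     (\<exists>\<rho>. d * (c * c) = 1 + 4 * \<rho> \<and> vge v 0 \<rho>)"
    using square_class_normal_form[OF d] by blast
  have "x \<in> nrm (d * (c * c)) \<or> y \<in> nrm (d * (c * c)) \<or> x * y \<in> nrm (d * (c * c))"
  proof -
    have dc: "d * (c * c) \<noteq> 0" using d c by simp
    from nf show ?thesis
      using nrm_index_prime[OF dc _ xy] nrm_index_ramified_unit[OF _ _ _ _ _ xy]
        nrm_index_unramified[OF _ _ xy] by blast
  qed
  then show ?thesis by (simp add: nrm_scale[OF c])
qed

end

section \<open>Quaternion algebras\<close>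

locale quaternions =
  fixes A :: "'k::field_char_0 \<times> 'k"
  assumes division: "quat_division A"
begin

definition qquot :: "'k quat \<Rightarrow> 'k quat \<Rightarrow> 'k quat" where
  "qquot x y = qmul A x (qinv A y)"

lemmas quat_defs = qsub_def qscal_def qzero_def qone_def qsmult_def qinv_def

lemma qmul_coords:
  "qmul A (Quat x0 x1 x2 x3) (Quat y0 y1 y2 y3) =
     Quat (x0*y0 + fst A*x1*y1 + snd A*x2*y2 - fst A*snd A*x3*y3)
          (x0*y1 + x1*y0 - snd A*x2*y3 + snd A*x3*y2)
          (x0*y2 + x2*y0 + fst A*x1*y3 - fst A*x3*y1)
          (x0*y3 + x3*y0 + x1*y2 - x2*y1)"
  by (cases A) simp

lemma qnorm_coords:
  "qnorm A (Quat x0 x1 x2 x3) = x0*x0 - fst A*x1*x1 - snd A*x2*x2 + fst A*snd A*x3*x3"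
  by (cases A) simp

lemma qmul_conj_norm: "qmul A x (qconj x) = qscal (qnorm A x)"
  by (cases x) (simp add: qmul_coords qnorm_coords qscal_def algebra_simps)

lemma qconj_mul_norm: "qmul A (qconj x) x = qscal (qnorm A x)"
  by (cases x) (simp add: qmul_coords qnorm_coords qscal_def algebra_simps)

lemma qmul_assoc: "qmul A (qmul A x y) z = qmul A x (qmul A y z)"
  by (cases x; cases y; cases z) (simp add: qmul_coords algebra_simps)

lemma qscal_commute: "qmul A (qscal c) x = qmul A x (qscal c)"
  by (cases x) (simp add: qmul_coords qscal_def algebra_simps)

lemma qsmult_eq: "qsmult c x = qmul A (qscal c) x"
  by (cases x) (simp add: qmul_coords qscal_def qsmult_def algebra_simps)

lemma qnorm_eq_0_iff [simp]: "qnorm A x = 0 \<longleftrightarrow> x = qzero"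
  using division by (cases A) (auto simp: quat_division_def qzero_def qscal_def)

lemma qscal_mult: "qmul A (qscal c) (qscal d) = qscal (c * d)"
  by (simp add: qmul_coords qscal_def)

lemma qscal_one: "qscal 1 = qone"
  by (simp add: qone_def)

text \<open>The product depends on \<open>A\<close>, so the type cannot be a class instance;
  interpreting the locale of the class still provides its lemmas, under the prefix
  \<open>Q\<close>.\<close>

sublocale Q: division_ring qquot "qinv A" qone "qmul A" qadd qzero qsub qneg
proof
  fix a b c :: "'k quat"
  show "qmul A (qmul A a b) c = qmul A a (qmul A b c)" by (rule qmul_assoc)
  show "qadd (qadd a b) c = qadd a (qadd b c)" by (cases a; cases b; cases c) (simp add: algebra_simps)
  show "qadd a b = qadd b a" by (cases a; cases b) (simp add: algebra_simps)
  show "qadd qzero a = a" by (cases a) (simp add: quat_defs)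
  show "qadd (qneg a) a = qzero" by (cases a) (simp add: quat_defs)
  show "qsub a b = qadd a (qneg b)" by (simp add: qsub_def)
  show "qmul A (qadd a b) c = qadd (qmul A a c) (qmul A b c)"
    by (cases a; cases b; cases c) (simp add: qmul_coords algebra_simps)
  show "qmul A a (qadd b c) = qadd (qmul A a b) (qmul A a c)"
    by (cases a; cases b; cases c) (simp add: qmul_coords algebra_simps)
  show "qzero \<noteq> qone" by (simp add: quat_defs)
  show "qmul A qone a = a" by (cases a) (simp add: quat_defs qmul_coords)
  show "qmul A a qone = a" by (cases a) (simp add: quat_defs qmul_coords)
  show "qquot a b = qmul A a (qinv A b)" by (simp add: qquot_def)
  show "qinv A qzero = qzero" by (cases A) (simp add: quat_defs)
  have sm: "qinv A a = qmul A (qscal (inverse (qnorm A a))) (qconj a)"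
    by (simp add: qinv_def qsmult_eq)
  show "qmul A (qinv A a) a = qone" if "a \<noteq> qzero"
    using that by (simp add: sm qmul_assoc qconj_mul_norm qscal_mult qscal_one)
  show "qmul A a (qinv A a) = qone" if "a \<noteq> qzero"
    using that by (simp add: sm qmul_assoc[symmetric] qscal_commute[of _ a, symmetric])
      (simp add: qmul_assoc qmul_conj_norm qscal_mult qscal_one)
qed

notation qadd (infixl "\<oplus>" 65)
notation qsub (infixl "\<ominus>" 65)
abbreviation qtimes (infixl "\<odot>" 70) where "x \<odot> y \<equiv> qmul A x y"
abbreviation N :: "'k quat \<Rightarrow> 'k" where "N \<equiv> qnorm A"

lemma qscal_mul [simp]: "qscal c \<odot> x = qsmult c x" "x \<odot> qscal c = qsmult c x"
  by (simp_all add: qsmult_eq qscal_commute)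

lemma qsmult_simps [simp]:
  "qsmult c x \<odot> y = qsmult c (x \<odot> y)" "x \<odot> qsmult c y = qsmult c (x \<odot> y)"
  "qsmult c (qsmult d x) = qsmult (c * d) x" "qsmult c (qscal d) = qscal (c * d)"
  "qsmult 0 x = qzero" "qsmult 1 x = x" "qsmult c qzero = qzero"
  by (cases x; cases y; simp add: qsmult_def qscal_def qmul_coords qzero_def algebra_simps)+

lemma qsmult_distrib [algebra_simps]:
  "qsmult c (x \<oplus> y) = qsmult c x \<oplus> qsmult c y" "qsmult c (x \<ominus> y) = qsmult c x \<ominus> qsmult c y"
  "qsmult (c + d) x = qsmult c x \<oplus> qsmult d x" "qsmult (c - d) x = qsmult c x \<ominus> qsmult d x"
  by (cases x; cases y; simp add: qsmult_def qscal_def qsub_def algebra_simps)+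

lemma qsmult_neg [simp]: "qsmult c (qneg x) = qneg (qsmult c x)" "qsmult (- c) x = qneg (qsmult c x)"
  by (cases x; simp add: qsmult_def qscal_def)+

lemma qscal_simps [simp]:
  "qscal c \<oplus> qscal d = qscal (c + d)" "qscal c \<ominus> qscal d = qscal (c - d)"
  "qneg (qscal c) = qscal (- c)" "qscal c = qscal d \<longleftrightarrow> c = d" "qscal c = qzero \<longleftrightarrow> c = 0"
  "qscal 0 = qzero" "qscal 1 = qone"
  by (simp_all add: qscal_def qsub_def qzero_def qone_def)

lemma qconj_simps [simp]:
  "qconj (x \<oplus> y) = qconj x \<oplus> qconj y" "qconj (x \<ominus> y) = qconj x \<ominus> qconj y"
  "qconj (qneg x) = qneg (qconj x)" "qconj (x \<odot> y) = qconj y \<odot> qconj x"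
  "qconj (qsmult c x) = qsmult c (qconj x)" "qconj (qscal c) = qscal c"
  "qconj (qconj x) = x" "qconj qzero = qzero" "qconj qone = qone"
  by (cases x; cases y; simp add: qsmult_def qmul_coords qscal_def qsub_def qzero_def qone_def algebra_simps)+

lemma qnorm_simps [simp]:
  "N (x \<odot> y) = N x * N y" "N (qconj x) = N x" "N (qneg x) = N x" "N (qscal c) = c * c"
  "N (qsmult c x) = c * c * N x" "N qone = 1" "N qzero = 0"
  by (cases x; cases y; simp add: qsmult_def qmul_coords qnorm_coords qscal_def qzero_def qone_def algebra_simps)+

lemma qnorm_inverse [simp]: "N (qinv A x) = inverse (N x)"
proof (cases "x = qzero")
  case False
  then have "N x * N (qinv A x) = 1" unfolding qnorm_simps(1)[symmetric] by simp
  then show ?thesis by (metis inverse_unique)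
qed simp

lemma qconj_eq_0_iff [simp]: "qconj (x :: 'k quat) = qzero \<longleftrightarrow> x = qzero"
  by (metis qconj_simps(7,8))

lemma qmul_conj [simp]: "x \<odot> qconj x = qscal (N x)" "qconj x \<odot> x = qscal (N x)"
  by (rule qmul_conj_norm qconj_mul_norm)+

lemma qmul_conj_left [simp]: "x \<odot> (qconj x \<odot> y) = qsmult (N x) y" "qconj x \<odot> (x \<odot> y) = qsmult (N x) y"
  by (simp_all add: qmul_assoc[symmetric])

lemma qinv_left [simp]: "x \<noteq> qzero \<Longrightarrow> x \<odot> (qinv A x \<odot> y) = y" "x \<noteq> qzero \<Longrightarrow> qinv A x \<odot> (x \<odot> y) = y"
  by (simp_all add: qmul_assoc[symmetric])

lemma qeq_neg_iff [simp]: "(x :: 'k quat) = qneg x \<longleftrightarrow> x = qzero"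
  by (cases x) (auto simp: qzero_def qscal_def eq_neg_iff_add_eq_0)

section \<open>Pure quaternions and the quadratic fields they generate\<close>

lemma self_conj_scalar: "qconj (x :: 'k quat) = x \<Longrightarrow> \<exists>c. x = qscal c"
  by (cases x) (auto simp: qscal_def neg_eq_iff_add_eq_0 eq_neg_iff_add_eq_0)

lemma pure_conj: "pure_quat a \<Longrightarrow> qconj a = qneg a"
  by (simp add: pure_quat_def)

lemma pure_square: "pure_quat a \<Longrightarrow> a \<odot> a = qscal (- N a)"
  using qmul_conj(1)[of a] by (simp add: pure_quat_def) (metis Q.minus_minus qscal_simps(3))

lemma pure_scalar: "pure_quat (qscal (c :: 'k)) \<Longrightarrow> c = 0"
  by (auto simp: pure_quat_def)

text \<open>The reduced trace, read off as the linear term of the norm of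
  \<open>qone \<oplus> x\<close>.\<close>

definition qtr :: "'k quat \<Rightarrow> 'k" where "qtr x = N (qone \<oplus> x) - 1 - N x"

lemma qtr_conj: "x \<oplus> qconj x = qscal (qtr x)"
  by (cases x) (simp add: qtr_def qnorm_coords qscal_def qone_def algebra_simps)

lemma qnorm_one_add: "N (qone \<oplus> x) = 1 + qtr x + N x"
  by (simp add: qtr_def)

lemma qnorm_add_ortho:
  assumes "x \<odot> qconj y \<oplus> y \<odot> qconj x = qzero"
  shows "N (x \<oplus> y) = N x + N y"
proof -
  have "qscal (N (x \<oplus> y)) = (x \<oplus> y) \<odot> qconj (x \<oplus> y)" by (simp only: qmul_conj)
  also have "\<dots> = qscal (N x + N y) \<oplus> (x \<odot> qconj y \<oplus> y \<odot> qconj x)"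
    by (simp add: Q.distrib_left Q.distrib_right Q.add_ac flip: qscal_simps(1))
  finally show ?thesis using assms by simp
qed

lemma qnorm_pure_span:
  assumes "pure_quat a"
  shows "N (qscal x \<oplus> qsmult y a) = x * x + N a * y * y"
  by (subst qnorm_add_ortho) (simp_all add: pure_conj[OF assms] mult_ac)

lemma pure_span_zero:
  fixes a :: "'k quat"
  assumes "pure_quat a" "a \<noteq> qzero" "qscal x \<oplus> qsmult y a = qzero"
  shows "x = 0 \<and> y = 0"
proof -
  have "qsmult y a = qscal (- x)" using Q.minus_unique[OF assms(3), symmetric] by simp
  then have "pure_quat (qscal (- x))" using assms(1)
    by (metis pure_quat_def qconj_simps(5) qsmult_neg(1))
  then have x: "x = 0" using pure_scalar by force
  with assms(3) have "N (qsmult y a) = 0" by simp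
  with assms(2) x show ?thesis by simp
qed

text \<open>A pure \<open>a\<close> has square \<open>- N a\<close>, so \<open>k(a)\<close> is
  \<open>k(sqrt(- N a))\<close>; as \<open>D\<close> is a division algebra, only the zero pair has
  norm 0.\<close>

lemma norms_from_eq_nrm:
  assumes "pure_quat a" "a \<noteq> qzero"
  shows "norms_from A a = nrm (- N a)"
proof -
  have "N (qscal x \<oplus> qsmult y a) \<noteq> 0 \<longleftrightarrow> (x, y) \<noteq> (0, 0)" for x y
    using pure_span_zero[OF assms] by auto
  then show ?thesis unfolding norms_from_def nrm_def
    by (auto simp: qnorm_pure_span[OF assms(1)]) (metis qnorm_pure_span[OF assms(1)])+
qed

lemma norm_in_nrm: "pure_quat a \<Longrightarrow> a \<noteq> qzero \<Longrightarrow> N a \<in> nrm (- N a)"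
  unfolding nrm_def by (intro CollectI conjI exI[of _ 0] exI[of _ 1]) auto

lemma nonsquare_neg_norm:
  assumes "pure_quat a" "a \<noteq> qzero"
  shows "x * x = - N a * y * y \<Longrightarrow> x = 0 \<and> y = 0"
  using pure_span_zero[OF assms, of x y] qnorm_pure_span[OF assms(1), of x y]
  by (simp del: qnorm_eq_0_iff add: qnorm_eq_0_iff[symmetric])

text \<open>\<open>- N a\<close> is not a square, so \<open>u\<close> is nonzero in every nontrivial
  solution and one may divide by it.\<close>

lemma hilbert_nrm:
  assumes a: "pure_quat a" "a \<noteq> qzero" and x: "x \<noteq> 0"
  shows "hilbert x (- N a) = -1 \<longleftrightarrow> x \<notin> nrm (- N a)"
proof -
  have "(\<exists>u w z. (u, w, z) \<noteq> (0, 0, 0) \<and> z * z = x * u * u + - N a * w * w) \<longleftrightarrow> x \<in> nrm (- N a)"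
  proof
    assume "\<exists>u w z. (u, w, z) \<noteq> (0, 0, 0) \<and> z * z = x * u * u + - N a * w * w"
    then obtain u w z where *: "(u, w, z) \<noteq> (0, 0, 0)" "z * z = x * u * u + - N a * w * w" by blast
    have u: "u \<noteq> 0" using * nonsquare_neg_norm[OF a, of z w] by auto
    have "x * u * u = z * z - - N a * w * w" using *(2) by simp
    then have "x = (z / u) * (z / u) - - N a * (w / u) * (w / u)"
      using u by (simp add: divide_simps mult.assoc)
    then show "x \<in> nrm (- N a)" using x unfolding nrm_def by blast
  next
    assume "x \<in> nrm (- N a)"
    then obtain p q where "x = p * p - - N a * q * q" by (auto simp: nrm_def)
    then have "p * p = x * 1 * 1 + - N a * q * q" by simp
    then show "\<exists>u w z. (u, w, z) \<noteq> (0, 0, 0) \<and> z * z = x * u * u + - N a * w * w"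
      by (intro exI[of _ 1] exI[of _ q] exI[of _ p]) simp
  qed
  then show ?thesis by (simp add: hilbert_def)
qed

text \<open>The commutator of \<open>a\<close> with any \<open>x\<close> is pure and anticommutes
  with \<open>a\<close>, because the square of \<open>a\<close> is central; some commutator with
  \<open>i\<close> or \<open>j\<close> is nonzero, since \<open>a\<close> is not a scalar.\<close>

lemma anticommuting_exists:
  assumes a: "pure_quat a" "a \<noteq> qzero"
  shows "\<exists>j. j \<noteq> qzero \<and> pure_quat j \<and> a \<odot> j = qneg (j \<odot> a)"
proof -
  define c where "c x = a \<odot> x \<ominus> x \<odot> a" for x
  have ac: "a \<odot> c x = qneg (c x \<odot> a)" for x
    using pure_square[OF a(1)]
    by (simp add: c_def Q.right_diff_distrib Q.left_diff_distrib qmul_assoc)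
      (simp add: qmul_assoc[symmetric] Q.minus_diff_commute)
  have "pure_quat (c x)" for x
  proof -
    have x: "qconj x = qscal (qtr x) \<ominus> x" using qtr_conj[of x] by (simp add: Q.eq_diff_eq Q.add.commute)
    have "qconj (c x) = a \<odot> qconj x \<ominus> qconj x \<odot> a" by (simp add: c_def pure_conj[OF a(1)])
    also have "\<dots> = qneg (c x)" unfolding x by (simp add: c_def algebra_simps)
    finally show ?thesis by (simp add: pure_quat_def)
  qed
  moreover have "\<exists>x. c x \<noteq> qzero"
  proof (rule ccontr)
    assume "\<not> ?thesis"
    then have c0: "c (Quat 0 1 0 0) = qzero" "c (Quat 0 0 1 0) = qzero" by auto
    obtain a0 a1 a2 a3 where a': "a = Quat a0 a1 a2 a3" by (cases a)
    have "fst A \<noteq> 0" using qnorm_eq_0_iff[of "Quat 0 1 0 0"] by (auto simp: qnorm_coords qzero_def qscal_def)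
    then show False using a c0 
      by (auto simp: a' c_def qmul_coords qsub_def qzero_def qscal_def pure_quat_def
            eq_neg_iff_add_eq_0 neg_eq_iff_add_eq_0)
  qed
  ultimately show ?thesis using ac by blast
qed

text \<open>If \<open>- N j\<close> were \<open>N w\<close> with \<open>w\<close> in
  \<open>k(a)\<close>, orthogonality of \<open>w\<close> and \<open>j\<close> would give
  \<open>N (w \<oplus> j) = 0\<close>, so \<open>j = qneg w\<close> would commute with
  \<open>a\<close>. With \<open>nrm_index_two\<close> the norm group has index exactly 2.\<close>

lemma anticommuting_nonnorm:
  assumes a: "pure_quat a" "a \<noteq> qzero" and j: "j \<noteq> qzero" "pure_quat j" "a \<odot> j = qneg (j \<odot> a)"
  shows "- N j \<notin> nrm (- N a)"
proof
  assume "- N j \<in> nrm (- N a)"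
  then obtain x y where xy: "- N j = x * x - - N a * y * y" by (auto simp: nrm_def)
  define w where "w = qscal x \<oplus> qsmult y a"
  have "w \<odot> qconj j \<oplus> j \<odot> qconj w = qzero"
    using j by (simp add: w_def pure_conj[OF a(1)] pure_conj[OF j(2)] Q.distrib_left Q.distrib_right)
      (simp add: algebra_simps)
  from qnorm_add_ortho[OF this] have "N (w \<oplus> j) = N w + N j" .
  also have "N w = - N j" using xy by (simp add: w_def qnorm_pure_span[OF a(1)])
  finally have "N (w \<oplus> j) = 0" by simp
  then have "j = qneg w" using Q.minus_unique[of w j] by simp
  moreover have "a \<odot> w = w \<odot> a" by (simp add: w_def Q.distrib_left Q.distrib_right)
  ultimately have "a \<odot> j = j \<odot> a" by simp
  then have "j \<odot> a = qzero" using j(3) by (metis qeq_neg_iff)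
  then show False using a j by simp
qed

text \<open>Taking norms leaves \<open>N u = 1\<close> or \<open>N u = - 1\<close>. In the second
  case \<open>u\<close> anticommutes with \<open>a\<close>, so it has trace 0 and square 1; but then
  it is 1 or -1, of norm 1.\<close>

lemma unitary_commutes:
  assumes a: "pure_quat a" "a \<noteq> qzero" and u: "u \<odot> a \<odot> qconj u = a"
  shows "N u = 1 \<and> u \<odot> a = a \<odot> u"
proof -
  have "N u * N u * N a = N a" using arg_cong[OF u, of N] by (simp add: mult_ac)
  then have "N u * N u = 1" using a(2) by simp
  then have pm: "N u = 1 \<or> N u = - 1" by (simp add: square_eq_1_iff)
  have "u \<odot> a \<odot> qconj u \<odot> u = a \<odot> u" using u by simp
  then have comm: "qsmult (N u) (u \<odot> a) = a \<odot> u" by (simp add: qmul_assoc)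
  have "N u \<noteq> - 1"
  proof
    assume n: "N u = - 1"
    then have au: "a \<odot> u = qneg (u \<odot> a)" using comm by simp
    have "qneg (qconj u \<odot> a) = a \<odot> qconj u"
      using arg_cong[OF au, of qconj] by (simp add: pure_conj[OF a(1)])
    then have "a \<odot> (u \<oplus> qconj u) = qneg ((u \<oplus> qconj u) \<odot> a)"
      using au by (simp add: Q.distrib_left Q.distrib_right Q.add.commute)
    then have "qsmult (qtr u) a = qneg (qsmult (qtr u) a)" by (simp only: qtr_conj qscal_mul)
    then have "N (qsmult (qtr u) a) = 0" by simp
    then have "qtr u = 0" using a(2) by simp
    then have "pure_quat u" using Q.minus_unique[of u "qconj u"] qtr_conj[of u] by (simp add: pure_quat_def)
    then have "u \<odot> u = qone" using pure_square[of u] n by simp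
    then have "u = qone \<or> u = qneg qone" by (simp add: Q.square_eq_1_iff)
    then show False using n by auto
  qed
  then show ?thesis using pm comm by simp
qed

text \<open>\<open>w = u \<ominus> qconj u\<close> is pure and commutes with \<open>a\<close>, so
  \<open>w \<odot> a\<close> equals its conjugate and is a scalar; hence \<open>w\<close> is a
  multiple of \<open>a\<close>.\<close>

lemma commuting_span:
  assumes a: "pure_quat a" "a \<noteq> qzero" and u: "u \<odot> a = a \<odot> u"
  shows "\<exists>x y. u = qscal x \<oplus> qsmult y a"
proof -
  define w where "w = u \<ominus> qconj u"
  have "qconj u \<odot> a = a \<odot> qconj u"
    using arg_cong[OF u, of qconj] by (simp add: pure_conj[OF a(1)])
  then have wa: "w \<odot> a = a \<odot> w" using u by (simp add: w_def Q.left_diff_distrib Q.right_diff_distrib)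
  have "qconj (w \<odot> a) = w \<odot> a"
  proof -
    have "qconj w = qneg w" by (simp add: w_def)
    then have "qconj (w \<odot> a) = a \<odot> w" by (simp add: pure_conj[OF a(1)])
    then show ?thesis using wa by simp
  qed
  then obtain c where "w \<odot> a = qscal c" using self_conj_scalar by blast
  then have "w \<odot> a \<odot> a = qsmult c a" by simp
  then have "qsmult (- inverse (N a)) (qsmult (- N a) w) = qsmult (- inverse (N a)) (qsmult c a)"
    using pure_square[OF a(1)] by (simp only: qmul_assoc qscal_mul)
  then have w: "w = qsmult (- (c / N a)) a" using a(2) by (simp add: field_simps)
  have "qsmult 2 u = (u \<oplus> qconj u) \<oplus> w"
    by (cases u) (simp add: w_def qsmult_def qscal_def qsub_def)
  also have "\<dots> = qscal (qtr u) \<oplus> qsmult (- (c / N a)) a" by (simp only: qtr_conj w)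
  finally have "qsmult (1/2) (qsmult 2 u) = qsmult (1/2) (qscal (qtr u) \<oplus> qsmult (- (c / N a)) a)"
    by (rule arg_cong)
  then have "u = qscal (1/2 * qtr u) \<oplus> qsmult (1/2 * - (c / N a)) a"
    by (simp only: qsmult_distrib qsmult_simps) simp
  then show ?thesis by blast
qed

text \<open>Such a \<open>u\<close> lies in \<open>k(a)\<close>, hence so does
  \<open>qone \<ominus> u\<close>. Up to the factor \<open>N a\<close> this is the spinor norm of
  right multiplication by \<open>u\<close> on the line with form \<open>a\<close>.\<close>

lemma unitary_norm:
  assumes a: "pure_quat a" "a \<noteq> qzero" and u: "u \<odot> a \<odot> qconj u = a" "u \<noteq> qone"
  shows "N (qone \<ominus> u) \<in> nrm (- N a)"
proof -
  obtain x y where xy: "u = qscal x \<oplus> qsmult y a"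
    using commuting_span[OF a] unitary_commutes[OF a u(1)] by blast
  have "qone \<ominus> u = qscal (1 - x) \<oplus> qsmult (- y) a"
    unfolding xy by (cases a) (simp add: qone_def qsmult_def qscal_def qsub_def)
  then have "N (qone \<ominus> u) = (1 - x) * (1 - x) - - N a * y * y"
    using qnorm_pure_span[OF a(1), of "1 - x" "- y"] by simp
  moreover have "N (qone \<ominus> u) \<noteq> 0" using u(2) by simp
  ultimately show ?thesis unfolding nrm_def by blast
qed

text \<open>Write \<open>e = N w\<close> with \<open>w\<close> in \<open>k(a)\<close>; since
  \<open>w\<close> commutes with \<open>a\<close>, replacing \<open>u\<close> by
  \<open>u \<odot> w\<close> contributes exactly the factor \<open>e\<close>.\<close>

lemma norm_twist:
  assumes a: "pure_quat a" and u: "u \<noteq> qzero" and e: "e \<in> nrm (- N a)"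
  shows "\<exists>l. l \<noteq> qzero \<and> qsmult e (u \<odot> a \<odot> qconj u) = l \<odot> a \<odot> qconj l"
proof -
  obtain x y where xy: "e = x * x - - N a * y * y" and "e \<noteq> 0" using e by (auto simp: nrm_def)
  define w where "w = qscal x \<oplus> qsmult y a"
  have Nw: "N w = e" using xy by (simp add: w_def qnorm_pure_span[OF a])
  then have w0: "w \<noteq> qzero" using \<open>e \<noteq> 0\<close> by auto
  have "w \<odot> a = a \<odot> w" by (simp add: w_def Q.distrib_left Q.distrib_right)
  then have "u \<odot> w \<odot> a \<odot> qconj (u \<odot> w) = u \<odot> (a \<odot> (w \<odot> (qconj w \<odot> qconj u)))"
    by (simp only: qconj_simps qmul_assoc[symmetric]) (simp only: qmul_assoc)
  also have "\<dots> = qsmult e (u \<odot> a \<odot> qconj u)" by (simp add: Nw qmul_assoc)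
  finally show ?thesis using u w0 by (intro exI[of _ "u \<odot> w"]) simp
qed

end

locale local_quaternions = dyadic v + quaternions A
  for v :: "'k::field_char_0 \<Rightarrow> int" and A :: "'k \<times> 'k"
begin

text \<open>Pure quaternions of equal norm are conjugate, so \<open>b\<close> is a scalar times
  \<open>u \<odot> a \<odot> qconj u\<close>. If the scalar is not a norm from \<open>k(a)\<close>,
  replacing \<open>u\<close> by \<open>u \<odot> j\<close> changes it by the nonnorm
  \<open>- N j\<close>, and index 2 makes it a norm.\<close>

lemma pure_represents:
  assumes a: "pure_quat a" "a \<noteq> qzero" and b: "pure_quat b" "b \<noteq> qzero"
    and c: "c \<noteq> 0" "N b = N a * (c * c)"
  shows "\<exists>l. l \<noteq> qzero \<and> b = l \<odot> a \<odot> qconj l"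
proof -
  obtain j where j: "j \<noteq> qzero" "pure_quat j" "a \<odot> j = qneg (j \<odot> a)"
    using anticommuting_exists[OF a] by blast
  define b' where "b' = qsmult (inverse c) b"
  have pb': "pure_quat b'" using b by (simp add: b'_def pure_quat_def)
  have "N b' = N a" using c by (simp add: b'_def field_simps)
  then have sq: "b' \<odot> b' = a \<odot> a" using pure_square[OF a(1)] pure_square[OF pb'] by simp
  have bb': "b = qsmult c b'" using c by (simp add: b'_def)
  \<comment> \<open>\<open>a \<oplus> b'\<close> intertwines \<open>a\<close> and \<open>b'\<close>
    because their squares agree; if it vanishes, then \<open>b' = qneg a\<close> and
    \<open>j\<close> intertwines them.\<close>
  obtain u where u: "u \<noteq> qzero" "b' \<odot> u = u \<odot> a"
  proof (cases "a \<oplus> b' = qzero")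
    case True
    then have "b' = qneg a" using Q.minus_unique by metis
    then show ?thesis using that[of j] j by simp
  next
    case False
    then show ?thesis using that[of "a \<oplus> b'"] sq by (simp add: Q.distrib_left Q.distrib_right Q.add.commute)
  qed
  have "b' \<odot> u \<odot> qconj u = u \<odot> a \<odot> qconj u" using u by simp
  then have "qsmult (N u) b' = u \<odot> a \<odot> qconj u" by (simp add: qmul_assoc)
  then have "qsmult (c / N u) (qsmult (N u) b') = qsmult (c / N u) (u \<odot> a \<odot> qconj u)" by simp
  then have b_eq: "b = qsmult (c / N u) (u \<odot> a \<odot> qconj u)" using u by (simp add: bb')
  show ?thesis
  proof (cases "c / N u \<in> nrm (- N a)")
    case True
    then show ?thesis using norm_twist[OF a(1) u(1) True] b_eq by simp
  next
    case False
    have nz: "- N a \<noteq> 0" "c / N u \<noteq> 0" "- N j \<noteq> 0" using a c u j by auto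
    have "c / N u * - N j \<in> nrm (- N a)"
      using nrm_index_two[OF nz] False anticommuting_nonnorm[OF a j] by blast
    then have "c / N u * - N j * (inverse (N j) * inverse (N j)) \<in> nrm (- N a)"
      using nz by (subst nrm_mult_square_iff) auto
    moreover have "c / N u * - N j * (inverse (N j) * inverse (N j)) = c / N u * - inverse (N j)"
      using nz by (simp add: mult.assoc[symmetric])
    ultimately have e: "c / N u * - inverse (N j) \<in> nrm (- N a)" by (simp only:)
    have ja: "j \<odot> a = qneg (a \<odot> j)" using j(3) by simp
    have "u \<odot> j \<odot> a \<odot> qconj (u \<odot> j) = u \<odot> (j \<odot> a) \<odot> (qconj j \<odot> qconj u)"
      by (simp only: qconj_simps qmul_assoc)
    also have "\<dots> = qsmult (- N j) (u \<odot> a \<odot> qconj u)" unfolding ja by (simp add: qmul_assoc)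
    finally have "qsmult (c / N u * - inverse (N j)) (u \<odot> j \<odot> a \<odot> qconj (u \<odot> j))
        = qsmult (c / N u * - inverse (N j) * - N j) (u \<odot> a \<odot> qconj u)"
      by (simp only: qsmult_simps)
    also have "\<dots> = b" using nz b_eq by (simp add: mult.assoc)
    finally show ?thesis using norm_twist[OF a(1) _ e, of "u \<odot> j"] u j by simp
  qed
qed

section \<open>The valuation of \<open>D\<close>: integral traces and the ultrametric
  inequality\<close>

lemma qnorm_sub_scal: "N (w \<ominus> qscal X) = N w - X * qtr w + X * X"
  by (cases w) (simp add: qtr_def qnorm_coords qscal_def qsub_def qone_def algebra_simps)

text \<open>Otherwise Hensel's lemma would split the characteristic polynomial of \<open>w\<close> over \<open>k\<close>.\<close>
lemma trace_integral:
  assumes "vge v 0 (N w)"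
  shows "vge v 0 (qtr w)"
proof (rule ccontr)
  assume *: "\<not> ?thesis"
  then have T: "qtr w \<noteq> 0" "v (qtr w) \<le> - 1" by (auto simp: vge_def)
  have "vge v (0 - v (qtr w * qtr w)) (N w / (qtr w * qtr w))"
    using assms T by (intro vge_divide) auto
  then have "vge v 1 (N w / (qtr w * qtr w))" by (rule vge_mono) (use T in \<open>simp add: v_mult\<close>)
  from hensel_quadratic[OF this] obtain z where z: "z = 1 + N w / (qtr w * qtr w) * z * z" by blast
  \<comment> \<open>This scaling turns the fixed-point equation for \<open>z\<close> into
    \<open>N w - X * qtr w + X * X = 0\<close>.\<close>
  define X where "X = N w / qtr w * z"
  have "N w - X * qtr w + X * X = N w * (1 + N w / (qtr w * qtr w) * z * z - z)"
    using T by (simp add: X_def field_simps)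
  also have "\<dots> = 0" using z by simp
  finally have "N (w \<ominus> qscal X) = 0" by (simp only: qnorm_sub_scal)
  then have w: "w = qscal X" by simp
  then have "vge v (2 * 0) (X * X)" using assms by simp
  then have "vge v 0 X" by (simp only: vge_square_iff)
  moreover have "qtr w = 2 * X" using qtr_conj[of w] w by simp
  ultimately have "vge v 0 (qtr w)" using vge_mult0[OF two_small] vge_one_nonneg by metis
  then show False using * by simp
qed

text \<open>Factoring out the element of smaller valuation reduces to \<open>qone \<oplus> w\<close>
  with \<open>w\<close> integral, whose norm \<open>1 + qtr w + N w\<close> is integral by
  \<open>trace_integral\<close>.\<close>

lemma norm_ultrametric:
  assumes "vge v M (N x)" "vge v M (N y)"
  shows "vge v M (N (x \<oplus> y))"
proof -
  have main: "vge v M (N (y \<oplus> x))" if "y \<noteq> qzero" "vge v M (N y)" "vge v (v (N y)) (N x)" for x y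
  proof -
    define w where "w = qinv A y \<odot> x"
    have "vge v 0 (N x / N y)" using vge_divide[OF that(3), of "N y"] that(1) by simp
    then have w0: "vge v 0 (N w)" by (simp add: w_def divide_inverse mult.commute)
    have "y \<oplus> x = y \<odot> (qone \<oplus> w)" using that(1) by (simp add: w_def Q.distrib_left)
    moreover have "vge v 0 (N (qone \<oplus> w))"
      unfolding qnorm_one_add by (intro vge_add vge_one trace_integral w0)
    ultimately show ?thesis using vge_mult0[OF that(2)] by simp
  qed
  show ?thesis
  proof (cases "x = qzero \<or> y = qzero")
    case True
    then show ?thesis using assms by auto
  next
    case False
    then show ?thesis using main[of x y] main[of y x] assms
      by (cases "v (N x) \<le> v (N y)") (auto simp: vge_def Q.add.commute)
  qed
qed

lemma norm_ultrametric_diff: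
  "vge v M (N x) \<Longrightarrow> vge v M (N y) \<Longrightarrow> vge v M (N (x \<ominus> y))"
  using norm_ultrametric[of M x "qneg y"] by simp

end

section \<open>Isometries of the skew-hermitian plane and their spinor norms\<close>

text \<open>The equation for \<open>m\<close> says that the vector \<open>(m, qone)\<close> is
  isotropic, so the plane is hyperbolic; \<open>val_a\<close> is the bound
  \<open>|2 a1| \<ge> |a2|\<close>, the scalar 2 having norm 4.\<close>

locale skew_plane = local_quaternions v A
  for v :: "'k::field_char_0 \<Rightarrow> int" and A :: "'k \<times> 'k" +
  fixes a1 a2 m :: "'k quat"
  assumes pure1: "pure_quat a1" and pure2: "pure_quat a2"
    and a1_nz: "a1 \<noteq> qzero" and a2_nz: "a2 \<noteq> qzero"
    and hyperbolic: "m \<odot> a1 \<odot> qconj m = qneg a2" and m_nz: "m \<noteq> qzero"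
    and val_a: "v 4 + v (N a1) \<le> v (N a2)"
begin

abbreviation h where "h \<equiv> hform A a1 a2"
abbreviation R where "R \<equiv> rot A a1 a2"
abbreviation normK :: "'k set" where "normK \<equiv> nrm (- N a1)"

lemmas conj_a = pure_conj[OF pure1] pure_conj[OF pure2]

lemma sub_sub_cancel [simp]: "x \<ominus> (x \<ominus> y) = (y :: 'k quat)"
  by (cases x; cases y) (simp add: qsub_def)

lemma N_a2: "N a2 = N a1 * (N m * N m)"
  using arg_cong[OF hyperbolic, of N] by (simp add: mult_ac)

lemma normK_a2: "nrm (- N a2) = normK"
  using nrm_scale[of "N m" "- N a1"] m_nz by (simp add: N_a2)

lemma N_a1_normK: "N a1 \<in> normK" and N_a2_normK: "N a2 \<in> normK"
  using norm_in_nrm[OF pure1 a1_nz] norm_in_nrm[OF pure2 a2_nz] normK_a2 by simp_all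

lemma h_sub_left: "h (vsub x (vsmult A k s)) y = h x y \<ominus> k \<odot> h s y"
  by (simp add: hform_def vsub_def vsmult_def Q.left_diff_distrib Q.right_diff_distrib
      Q.distrib_left qmul_assoc) (simp add: algebra_simps)

lemma h_sub_right: "h y (vsub x (vsmult A k s)) = h y x \<ominus> h y s \<odot> qconj k"
  by (simp add: hform_def vsub_def vsmult_def Q.left_diff_distrib Q.right_diff_distrib
      Q.distrib_right qmul_assoc) (simp add: algebra_simps)

lemma h_skew: "qconj (h x y) = qneg (h y x)"
  by (simp add: hform_def conj_a qmul_assoc Q.add.commute)

section \<open>Simple rotations\<close>

lemma rot_dataD:
  assumes "rot_data A a1 a2 (s, \<sigma>)"
  shows "\<sigma> \<noteq> qzero" "h s s = \<sigma> \<ominus> qconj \<sigma>"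
  using assms by (simp_all add: rot_data_def)

lemma rot_data_conj: "rot_data A a1 a2 (s, \<sigma>) \<Longrightarrow> rot_data A a1 a2 (s, qneg (qconj \<sigma>))"
  by (simp add: rot_data_def Q.add.commute)

lemma rot_form:
  assumes "rot_data A a1 a2 (s, \<sigma>)"
  shows "h (R (s, \<sigma>) x) (R (s, \<sigma>) y) = h x y"
proof -
  note d = rot_dataD[OF assms]
  define k l where "k = h x s \<odot> qinv A \<sigma>" and "l = h y s \<odot> qinv A \<sigma>"
  have hx: "h x s = k \<odot> \<sigma>" and "h y s = l \<odot> \<sigma>" using d(1) by (simp_all add: k_def l_def qmul_assoc)
  then have hy: "h s y = qneg (qconj \<sigma> \<odot> qconj l)" using h_skew[of y s] by simp
  have "h (R (s, \<sigma>) x) (R (s, \<sigma>) y) = h x y \<ominus> k \<odot> h s y \<ominus> (h x s \<ominus> k \<odot> h s s) \<odot> qconj l"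
    by (simp only: rot_def fst_conv snd_conv k_def[symmetric] l_def[symmetric] h_sub_left h_sub_right)
  also have "\<dots> = h x y"
    unfolding hx hy d(2) by (simp add: Q.left_diff_distrib Q.right_diff_distrib qmul_assoc)
  finally show ?thesis .
qed

lemma rot_inverse:
  assumes "rot_data A a1 a2 (s, \<sigma>)"
  shows "R (s, qneg (qconj \<sigma>)) (R (s, \<sigma>) x) = x"
proof -
  note d = rot_dataD[OF assms]
  define k where "k = h x s \<odot> qinv A \<sigma>"
  have hx: "h x s = k \<odot> \<sigma>" using d(1) by (simp add: k_def qmul_assoc)
  have r: "R (s, \<sigma>) x = vsub x (vsmult A k s)" by (simp add: rot_def k_def)
  have "h (vsub x (vsmult A k s)) s = k \<odot> qconj \<sigma>"
    unfolding h_sub_left hx d(2) by (simp add: Q.right_diff_distrib)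
  then have "R (s, qneg (qconj \<sigma>)) (vsub x (vsmult A k s))
      = vsub (vsub x (vsmult A k s)) (vsmult A (qneg k) s)"
    using d(1) by (simp add: rot_def qmul_assoc Q.nonzero_inverse_minus_eq)
  then show ?thesis unfolding r by (simp add: vsub_def vsmult_def)
qed

lemma rot_linear: "R p (vadd (vsmult A d x) y) = vadd (vsmult A d (R p x)) (R p y)"
proof -
  have "h (vadd (vsmult A d x) y) z = d \<odot> h x z \<oplus> h y z" for z
    by (simp add: hform_def vadd_def vsmult_def Q.distrib_left Q.distrib_right qmul_assoc Q.add_ac)
  then show ?thesis
    by (simp add: rot_def vadd_def vsmult_def vsub_def Q.distrib_left Q.distrib_right
        Q.right_diff_distrib qmul_assoc) (simp add: algebra_simps)
qed

lemma rot_conj_inverse: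
  assumes "rot_data A a1 a2 (s, \<sigma>)"
  shows "R (s, \<sigma>) (R (s, qneg (qconj \<sigma>)) x) = x"
  using rot_inverse[OF rot_data_conj[OF assms]] by simp

lemma rot_isometry:
  assumes "rot_data A a1 a2 (s, \<sigma>)"
  shows "isometry A a1 a2 (R (s, \<sigma>))"
  unfolding isometry_def
proof (intro conjI allI)
  show "bij (R (s, \<sigma>))"
    using rot_inverse[OF assms] rot_conj_inverse[OF assms]
    by (intro o_bij[where g = "R (s, qneg (qconj \<sigma>))"]) (simp_all add: fun_eq_iff)
qed (simp_all add: rot_linear rot_form[OF assms])

lemma rot_stab:
  assumes "rot_data A a1 a2 (s, \<sigma>)"
    and "\<And>x. x \<in> lattice v A \<Longrightarrow> R (s, \<sigma>) x \<in> lattice v A"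
    and "\<And>x. x \<in> lattice v A \<Longrightarrow> R (s, qneg (qconj \<sigma>)) x \<in> lattice v A"
  shows "R (s, \<sigma>) \<in> stab v A a1 a2"
proof -
  have "lattice v A \<subseteq> R (s, \<sigma>) ` lattice v A"
  proof
    fix x assume "x \<in> lattice v A"
    then show "x \<in> R (s, \<sigma>) ` lattice v A"
      using assms(3) rot_conj_inverse[OF assms(1), of x] by (metis imageI)
  qed
  then show ?thesis using assms(2) rot_isometry[OF assms(1)] by (auto simp: stab_def)
qed

lemma stab_comp:
  assumes "f \<in> stab v A a1 a2" "g \<in> stab v A a1 a2"
  shows "f \<circ> g \<in> stab v A a1 a2"
proof -
  have "(f \<circ> g) ` lattice v A = f ` g ` lattice v A" by (rule image_comp[symmetric])
  also have "\<dots> = lattice v A" using assms by (simp add: stab_def)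
  finally show ?thesis
    using assms unfolding stab_def isometry_def by (simp add: bij_comp del: split_paired_All)
qed

text \<open>In the coordinates \<open>(X, Z)\<close> the form \<open>-2 h\<close> becomes \<open>X conj Z' - Z conj X'\<close>.\<close>
definition cX :: "'k vec \<Rightarrow> 'k quat" where "cX x = fst x \<oplus> snd x \<odot> m"
definition cZ :: "'k vec \<Rightarrow> 'k quat" where "cZ x = (fst x \<ominus> snd x \<odot> m) \<odot> a1"

lemma h_hyperbolic: "qsmult (- 2) (h x y) = cX x \<odot> qconj (cZ y) \<ominus> cZ x \<odot> qconj (cX y)"
proof -
  have 2: "qsmult (- 2) z = qneg z \<ominus> z" for z :: "'k quat"
    by (cases z) (simp add: qsmult_def qscal_def qsub_def)
  have "snd x \<odot> (m \<odot> a1 \<odot> qconj m) \<odot> qconj (snd y) = qneg (snd x \<odot> a2 \<odot> qconj (snd y))"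
    unfolding hyperbolic by simp
  then have e: "snd x \<odot> (m \<odot> (a1 \<odot> (qconj m \<odot> qconj (snd y)))) = qneg (snd x \<odot> (a2 \<odot> qconj (snd y)))"
    by (simp add: qmul_assoc)
  show ?thesis unfolding 2
    by (simp add: hform_def cX_def cZ_def conj_a Q.distrib_left Q.distrib_right Q.left_diff_distrib
        Q.right_diff_distrib qmul_assoc e) (simp add: algebra_simps)
qed

lemma cX_sub: "cX (vsub x (vsmult A k s)) = cX x \<ominus> k \<odot> cX s"
  by (simp add: cX_def vsub_def vsmult_def Q.distrib_left Q.left_diff_distrib qmul_assoc)
    (simp add: algebra_simps)

lemma cZ_sub: "cZ (vsub x (vsmult A k s)) = cZ x \<ominus> k \<odot> cZ s"
  by (simp add: cZ_def vsub_def vsmult_def Q.left_diff_distrib Q.right_diff_distrib qmul_assoc)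
    (simp add: algebra_simps)

text \<open>A relation, because \<open>n\<close> is determined only modulo squares. In the
  coordinates \<open>(cX, cZ)\<close> the map \<open>g\<close> multiplies a row vector by an
  invertible matrix over \<open>k\<close> and then by \<open>d\<close> from the right.\<close>

definition spin :: "('k vec \<Rightarrow> 'k vec) \<Rightarrow> 'k \<Rightarrow> bool" where
  "spin g n \<longleftrightarrow> (\<exists>p q r s d. p * s - q * r \<noteq> 0 \<and> d \<noteq> qzero \<and> (\<exists>e. e \<noteq> 0 \<and> N d = n * (e * e)) \<and>
     (\<forall>x. cX (g x) = (qsmult p (cX x) \<oplus> qsmult r (cZ x)) \<odot> d \<and>
          cZ (g x) = (qsmult q (cX x) \<oplus> qsmult s (cZ x)) \<odot> d))"

lemma spinI:
  assumes "p * s - q * r \<noteq> 0" "d \<noteq> qzero" "e \<noteq> 0" "N d = n * (e * e)"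
    "\<And>x. cX (g x) = (qsmult p (cX x) \<oplus> qsmult r (cZ x)) \<odot> d"
    "\<And>x. cZ (g x) = (qsmult q (cX x) \<oplus> qsmult s (cZ x)) \<odot> d"
  shows "spin g n"
  unfolding spin_def using assms by blast

lemma spin_id: "spin id 1"
  by (rule spinI[of 1 1 0 0 qone 1]) simp_all

lemma spin_neg:
  assumes "spin g n"
  shows "spin (\<lambda>x. (qneg (fst (g x)), qneg (snd (g x)))) n"
proof -
  obtain p q r s d e where *: "p * s - q * r \<noteq> 0" "d \<noteq> qzero" "e \<noteq> 0" "N d = n * (e * e)"
    "\<And>x. cX (g x) = (qsmult p (cX x) \<oplus> qsmult r (cZ x)) \<odot> d"
    "\<And>x. cZ (g x) = (qsmult q (cX x) \<oplus> qsmult s (cZ x)) \<odot> d"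
    using assms unfolding spin_def by blast
  have neg: "cX (qneg (fst x), qneg (snd x)) = qneg (cX x)" "cZ (qneg (fst x), qneg (snd x)) = qneg (cZ x)" for x
    by (simp_all add: cX_def cZ_def Q.left_diff_distrib Q.add.commute)
  show ?thesis using * by (intro spinI[of p s q r "qneg d" e]) (simp_all add: neg)
qed

text \<open>Entries in \<open>k\<close> are central, so the matrices and the right factors multiply
  separately.\<close>

lemma spin_comp:
  assumes "spin f n" "spin g n'"
  shows "spin (f \<circ> g) (n * n')"
proof -
  obtain p q r s d e where f: "p * s - q * r \<noteq> 0" "d \<noteq> qzero" "e \<noteq> 0" "N d = n * (e * e)"
    "\<And>x. cX (f x) = (qsmult p (cX x) \<oplus> qsmult r (cZ x)) \<odot> d"
    "\<And>x. cZ (f x) = (qsmult q (cX x) \<oplus> qsmult s (cZ x)) \<odot> d"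
    using assms(1) unfolding spin_def by blast
  obtain p' q' r' s' d' e' where g: "p' * s' - q' * r' \<noteq> 0" "d' \<noteq> qzero" "e' \<noteq> 0" "N d' = n' * (e' * e')"
    "\<And>x. cX (g x) = (qsmult p' (cX x) \<oplus> qsmult r' (cZ x)) \<odot> d'"
    "\<And>x. cZ (g x) = (qsmult q' (cX x) \<oplus> qsmult s' (cZ x)) \<odot> d'"
    using assms(2) unfolding spin_def by blast
  have "(p * p' + r * q') * (q * r' + s * s') - (q * p' + s * q') * (p * r' + r * s')
      = (p * s - q * r) * (p' * s' - q' * r')" by algebra
  then have det: "(p * p' + r * q') * (q * r' + s * s') - (q * p' + s * q') * (p * r' + r * s') \<noteq> 0"
    using f(1) g(1) by simp
  show ?thesis
    by (rule spinI[OF det, of "d' \<odot> d" "e * e'"])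
      (use f g in \<open>simp_all add: Q.distrib_left Q.distrib_right qsmult_distrib qmul_assoc Q.add_ac mult_ac\<close>)
qed

text \<open>The matrix and \<open>d\<close> are determined by \<open>g\<close> up to a scalar of
  \<open>k\<close>, which changes \<open>N d\<close> by a square.\<close>

lemma spin_unique:
  assumes "spin g n" "spin g n'"
  shows "\<exists>e. e \<noteq> 0 \<and> n = n' * (e * e)"
proof -
  obtain p q r s d e where f: "p * s - q * r \<noteq> 0" "d \<noteq> qzero" "e \<noteq> 0" "N d = n * (e * e)"
    "\<And>x. cX (g x) = (qsmult p (cX x) \<oplus> qsmult r (cZ x)) \<odot> d"
    "\<And>x. cZ (g x) = (qsmult q (cX x) \<oplus> qsmult s (cZ x)) \<odot> d"
    using assms(1) unfolding spin_def by blast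
  obtain p' q' r' s' d' e' where g: "p' * s' - q' * r' \<noteq> 0" "d' \<noteq> qzero" "e' \<noteq> 0" "N d' = n' * (e' * e')"
    "\<And>x. cX (g x) = (qsmult p' (cX x) \<oplus> qsmult r' (cZ x)) \<odot> d'"
    "\<And>x. cZ (g x) = (qsmult q' (cX x) \<oplus> qsmult s' (cZ x)) \<odot> d'"
    using assms(2) unfolding spin_def by blast
  \<comment> \<open>\<open>E\<close> spans the isotropic line on which \<open>cZ\<close> vanishes;
    evaluating \<open>g\<close> there isolates the products of \<open>p\<close> and \<open>q\<close>
    with \<open>d\<close>.\<close>
  define E where "E = (qone :: 'k quat, qinv A m)"
  have E: "cX E = qscal 2" "cZ E = qzero"
    using m_nz by (simp_all add: E_def cX_def cZ_def flip: qscal_simps(7)) 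
  have pq: "qsmult (2 * p) d = qsmult (2 * p') d'" "qsmult (2 * q) d = qsmult (2 * q') d'"
    using f(5,6)[of E] g(5,6)[of E] by (simp_all add: E mult.commute)
  have nd: "N d \<noteq> 0" "N d' \<noteq> 0" using f g by auto
  have key: "\<exists>e. e \<noteq> 0 \<and> n = n' * (e * e)" if "c \<noteq> 0" "qsmult (2 * c) d = qsmult (2 * c') d'" for c c'
  proof -
    have n: "4 * (c * c) * N d = 4 * (c' * c') * N d'"
      using arg_cong[OF that(2), of N] by (simp add: mult_ac)
    then have c': "c' \<noteq> 0" using that(1) nd by auto
    have "n = n' * ((c' * e' / (c * e)) * (c' * e' / (c * e)))"
      using n that(1) f(3) unfolding f(4) g(4) by (simp add: field_simps)
    then show ?thesis using c' that(1) f(3) g(3) by (intro exI[of _ "c' * e' / (c * e)"]) auto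
  qed
  have "p \<noteq> 0 \<or> q \<noteq> 0" using f(1) by auto
  then show ?thesis using key pq by blast
qed

lemma qtr_mul_conj: "qtr (x \<odot> y) = qtr (y \<odot> x)"
  by (cases x; cases y) (simp add: qtr_def qnorm_coords qmul_coords qone_def qscal_def algebra_simps)

lemma qnorm_add_scal: "N (w \<oplus> qscal c) = N w + c * qtr w + c * c"
  by (cases w) (simp add: qtr_def qnorm_coords qscal_def qone_def algebra_simps)

text \<open>In coordinates the inverse of \<open>\<tau>\<close> stands to the left of
  \<open>S\<close> and \<open>T\<close>. As \<open>\<tau>\<close> and
  \<open>S \<odot> qconj T\<close> differ by a scalar, it can be carried across both, where it
  becomes the inverse of \<open>\<delta>\<close>; the remaining coefficients lie in
  \<open>k\<close>.\<close>

lemma spin_rot: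
  assumes "rot_data A a1 a2 (s, \<sigma>)"
  shows "spin (R (s, \<sigma>)) (N \<sigma>)"
proof -
  note d = rot_dataD[OF assms]
  define S T where "S = cX s" and "T = cZ s"
  define \<tau> where "\<tau> = qsmult (- 2) \<sigma>"
  have tau0: "\<tau> \<noteq> qzero" using d(1) by (simp add: \<tau>_def flip: qnorm_eq_0_iff)
  have "\<tau> \<ominus> qconj \<tau> = S \<odot> qconj T \<ominus> T \<odot> qconj S"
    using h_hyperbolic[of s s] unfolding d(2) by (simp add: \<tau>_def S_def T_def qsmult_distrib)
  \<comment> \<open>The condition \<open>\<sigma> - conj \<sigma> = h(s,s)\<close> says precisely
    that this difference is a scalar.\<close>
  then have "qconj (\<tau> \<ominus> S \<odot> qconj T) = \<tau> \<ominus> S \<odot> qconj T"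
    by (simp add: algebra_simps)
  then obtain c where "\<tau> \<ominus> S \<odot> qconj T = qscal c" using self_conj_scalar by blast
  then have tau: "\<tau> = S \<odot> qconj T \<oplus> qscal c" by (simp add: Q.diff_eq_eq Q.add.commute)
  define \<delta> where "\<delta> = qconj T \<odot> S \<oplus> qscal c"
  have N\<delta>: "N \<delta> = N \<tau>"
    unfolding tau \<delta>_def qnorm_add_scal using qtr_mul_conj[of "qconj T" S] by simp
  then have \<delta>0: "\<delta> \<noteq> qzero" using tau0 by (metis qnorm_eq_0_iff)
  have SD: "S \<odot> \<delta> = \<tau> \<odot> S" and TD: "T \<odot> \<delta> = \<tau> \<odot> T"
    by (simp_all add: tau \<delta>_def Q.distrib_left Q.distrib_right qmul_assoc)
  have swap: "qinv A \<tau> \<odot> y = y \<odot> qinv A \<delta>" if "y \<odot> \<delta> = \<tau> \<odot> y" for y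
  proof -
    have "qinv A \<tau> \<odot> (y \<odot> \<delta>) \<odot> qinv A \<delta> = y \<odot> qinv A \<delta>" unfolding that using tau0 by simp
    then show ?thesis using \<delta>0 by (simp add: qmul_assoc)
  qed
  have k: "h x s \<odot> qinv A \<sigma> = (cX x \<odot> qconj T \<ominus> cZ x \<odot> qconj S) \<odot> qinv A \<tau>" for x
  proof -
    have "qinv A \<sigma> = qsmult (- 2) (qinv A \<tau>)"
    proof (rule Q.inverse_unique)
      have "\<sigma> \<odot> qsmult (- 2) (qinv A \<tau>) = \<tau> \<odot> qinv A \<tau>" by (simp only: \<tau>_def qsmult_simps)
      then show "\<sigma> \<odot> qsmult (- 2) (qinv A \<tau>) = qone" by (simp only: Q.right_inverse[OF tau0])
    qed
    then show ?thesis
      unfolding S_def T_def h_hyperbolic[symmetric] by (simp only: qsmult_simps)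
  qed
  have tr: "qconj T \<odot> S \<oplus> qconj S \<odot> T = qscal (qtr (qconj T \<odot> S))"
    using qtr_conj[of "qconj T \<odot> S"] by simp
  have cX: "cX (R (s, \<sigma>) x) = (qsmult c (cX x) \<oplus> qsmult (N S) (cZ x)) \<odot> qinv A \<delta>" for x
  proof -
    have "cX (R (s, \<sigma>) x) = cX x \<ominus> (cX x \<odot> qconj T \<ominus> cZ x \<odot> qconj S) \<odot> (qinv A \<tau> \<odot> S)"
      by (simp only: rot_def fst_conv snd_conv cX_sub k S_def qmul_assoc)
    also have "\<dots> = (cX x \<odot> \<delta> \<ominus> (cX x \<odot> qconj T \<ominus> cZ x \<odot> qconj S) \<odot> S) \<odot> qinv A \<delta>"
      unfolding swap[OF SD] using \<delta>0 by (simp add: Q.left_diff_distrib qmul_assoc)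
    also have "cX x \<odot> \<delta> \<ominus> (cX x \<odot> qconj T \<ominus> cZ x \<odot> qconj S) \<odot> S = qsmult c (cX x) \<oplus> qsmult (N S) (cZ x)"
      by (simp add: \<delta>_def Q.left_diff_distrib Q.distrib_left qmul_assoc) (simp add: algebra_simps)
    finally show ?thesis .
  qed
  have cZ: "cZ (R (s, \<sigma>) x) = (qsmult (- N T) (cX x) \<oplus> qsmult (qtr (qconj T \<odot> S) + c) (cZ x)) \<odot> qinv A \<delta>" for x
  proof -
    have "cZ (R (s, \<sigma>) x) = cZ x \<ominus> (cX x \<odot> qconj T \<ominus> cZ x \<odot> qconj S) \<odot> (qinv A \<tau> \<odot> T)"
      by (simp only: rot_def fst_conv snd_conv cZ_sub k T_def qmul_assoc)
    also have "\<dots> = (cZ x \<odot> \<delta> \<ominus> (cX x \<odot> qconj T \<ominus> cZ x \<odot> qconj S) \<odot> T) \<odot> qinv A \<delta>"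
      unfolding swap[OF TD] using \<delta>0 by (simp add: Q.left_diff_distrib qmul_assoc)
    also have "cZ x \<odot> \<delta> \<ominus> (cX x \<odot> qconj T \<ominus> cZ x \<odot> qconj S) \<odot> T
        = qsmult (- N T) (cX x) \<oplus> (cZ x \<odot> (qconj T \<odot> S \<oplus> qconj S \<odot> T) \<oplus> qsmult c (cZ x))"
      by (simp add: \<delta>_def Q.left_diff_distrib Q.distrib_left qmul_assoc) (simp add: algebra_simps)
    also have "\<dots> = qsmult (- N T) (cX x) \<oplus> qsmult (qtr (qconj T \<odot> S) + c) (cZ x)"
      unfolding tr qscal_mul by (simp only: qsmult_distrib)
    finally show ?thesis .
  qed
  \<comment> \<open>The determinant is \<open>N \<delta> = N \<tau> = 4 * N \<sigma>\<close>; the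
    right factor is \<open>qinv A \<delta>\<close>, so its norm is \<open>N \<sigma>\<close> up to
    squares.\<close>
  have det: "c * (qtr (qconj T \<odot> S) + c) - - N T * N S \<noteq> 0"
  proof -
    have "c * (qtr (qconj T \<odot> S) + c) - - N T * N S = N \<delta>"
      unfolding \<delta>_def qnorm_add_scal by (simp add: algebra_simps)
    then show ?thesis using \<delta>0 by simp
  qed
  show ?thesis
  proof (rule spinI[OF det _ _ _ cX cZ, of "inverse (2 * N \<sigma>)"])
    show "N (qinv A \<delta>) = N \<sigma> * (inverse (2 * N \<sigma>) * inverse (2 * N \<sigma>))"
    proof -
      have "inverse (4 * x) = x * (inverse (2 * x) * inverse (2 * x))" if "x \<noteq> 0" for x :: 'k
        using that by (simp add: field_simps)
      from this[of "N \<sigma>"] show ?thesis using d(1) by (simp add: N\<delta> \<tau>_def)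
    qed
  qed (use d(1) \<delta>0 in auto)
qed

lemma spin_rot_list:
  assumes "list_all (rot_data A a1 a2) ps"
  shows "spin (foldr (\<circ>) (map R ps) id) (prod_list (map (\<lambda>p. N (snd p)) ps))"
  using assms by (induction ps) (auto intro!: spin_id spin_comp spin_rot)

section \<open>Reduction of an isometry to one rotation\<close>

definition lin_iso :: "('k vec \<Rightarrow> 'k vec) \<Rightarrow> bool" where
  "lin_iso g \<longleftrightarrow> (\<forall>d x y. g (vadd (vsmult A d x) y) = vadd (vsmult A d (g x)) (g y)) \<and>
     (\<forall>x y. h (g x) (g y) = h x y)"

text \<open>\<open>g\<close> preserves the orthogonal complement of \<open>s1\<close>, which is the
  line through \<open>s2\<close>.\<close>

lemma fixing_s1:
  assumes g: "lin_iso g" "g s1 = s1"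
  shows "\<exists>u. u \<odot> a2 \<odot> qconj u = a2 \<and> g = (\<lambda>x. (fst x, snd x \<odot> u))"
proof -
  have lin: "g (vadd (vsmult A d x) y) = vadd (vsmult A d (g x)) (g y)"
    and form: "h (g x) (g y) = h x y" for d x y using g(1) unfolding lin_iso_def by blast+
  obtain p u where pu: "g s2 = (p, u)" by (cases "g s2")
  have "h (g s2) (g s1) = h s2 s1" by (rule form)
  then have p: "p = qzero" unfolding g(2) pu using a1_nz by (simp add: hform_def s1_def s2_def)
  have "h (g s2) (g s2) = h s2 s2" by (rule form)
  then have u: "u \<odot> a2 \<odot> qconj u = a2" unfolding pu p by (simp add: hform_def s2_def)
  have g0: "g vzero = vzero"
  proof -
    have z: "vadd (vsmult A (qneg qone) y) y = vzero" for y :: "'k vec"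
      by (simp add: vadd_def vsmult_def vzero_def)
    show ?thesis using lin[of "qneg qone" vzero vzero] by (simp only: z)
  qed
  have "g x = (fst x, snd x \<odot> u)" for x
  proof -
    have "x = vadd (vsmult A (fst x) s1) (vadd (vsmult A (snd x) s2) vzero)"
      by (simp add: vadd_def vsmult_def s1_def s2_def vzero_def)
    then have "g x = vadd (vsmult A (fst x) s1) (vadd (vsmult A (snd x) (p, u)) vzero)"
      by (metis lin g0 g(2) pu)
    then show ?thesis by (simp add: p vadd_def vsmult_def s1_def vzero_def)
  qed
  then show ?thesis using u by blast
qed

text \<open>For \<open>u \<noteq> qone\<close>, right multiplication by \<open>u\<close> on the
  second line is the rotation with \<open>s = (1 - u) s2\<close> and
  \<open>\<sigma> = a2 (1 - conj u)\<close>, and \<open>unitary_norm\<close> applies. For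
  \<open>u = qone\<close> this \<open>\<sigma>\<close> would vanish.\<close>

lemma spin_fixing_s1:
  assumes "lin_iso g" "g s1 = s1"
  shows "\<exists>n \<in> normK. spin g n"
proof -
  obtain u where u: "u \<odot> a2 \<odot> qconj u = a2" "g = (\<lambda>x. (fst x, snd x \<odot> u))"
    using fixing_s1[OF assms] by blast
  show ?thesis
  proof (cases "u = qone")
    case True
    then have "g = id" using u by auto
    then show ?thesis using spin_id nrm_one by blast
  next
    case False
    define s \<sigma> where "s = (qzero :: 'k quat, qone \<ominus> u)" and "\<sigma> = a2 \<odot> (qone \<ominus> qconj u)"
    have nz: "qone \<ominus> qconj u \<noteq> qzero" using False by (metis Q.right_minus_eq qconj_simps(7,9))
    then have s0: "\<sigma> \<noteq> qzero" using a2_nz by (simp add: \<sigma>_def)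
    have data: "rot_data A a1 a2 (s, \<sigma>)"
      using s0 u(1) by (simp add: rot_data_def s_def \<sigma>_def hform_def conj_a Q.left_diff_distrib
          Q.right_diff_distrib) (simp add: algebra_simps)
    have "R (s, \<sigma>) x = g x" for x
    proof -
      have "h x s = snd x \<odot> \<sigma>" by (simp add: hform_def s_def \<sigma>_def qmul_assoc)
      then show ?thesis using s0
        by (simp add: rot_def u(2) qmul_assoc) (simp add: s_def vsub_def vsmult_def Q.right_diff_distrib)
    qed
    then have "R (s, \<sigma>) = g" by blast
    moreover have "N \<sigma> \<in> normK"
    proof -
      have "N (qone \<ominus> qconj u) = N (qone \<ominus> u)" using qnorm_simps(2)[of "qone \<ominus> u"] by simp
      then show ?thesis using unitary_norm[OF pure2 a2_nz u(1) False] nrm_mult[OF N_a2_normK] normK_a2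
        by (simp add: \<sigma>_def)
    qed
    ultimately show ?thesis using spin_rot[OF data] by blast
  qed
qed

text \<open>The vector \<open>s\<close> is \<open>s1\<close> minus the intended image
  \<open>(r, l)\<close>, and \<open>\<sigma> = h s1 s\<close>, so \<open>s1\<close> goes to
  \<open>s1 - s\<close>. The assumed equation says that \<open>h\<close> takes the same value on
  \<open>(r, l)\<close> as on \<open>s1\<close>.\<close>

lemma witt_rotation:
  assumes r: "r \<noteq> qone" and eq: "a1 \<ominus> r \<odot> a1 \<odot> qconj r = l \<odot> a2 \<odot> qconj l"
  defines "s \<equiv> vsub (vsmult A (qone \<ominus> r) s1) (vsmult A l s2)" and "\<sigma> \<equiv> a1 \<odot> (qone \<ominus> qconj r)"
  shows "rot_data A a1 a2 (s, \<sigma>)" "R (s, \<sigma>) s1 = (r, l)"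
proof -
  have s: "s = (qone \<ominus> r, qneg l)" by (simp add: s_def vsub_def vsmult_def s1_def s2_def)
  have "qone \<ominus> qconj r \<noteq> qzero" using r by (metis Q.right_minus_eq qconj_simps(7,9))
  then have s0: "\<sigma> \<noteq> qzero" using a1_nz by (simp add: \<sigma>_def)
  have "h s s = a1 \<ominus> a1 \<odot> qconj r \<ominus> r \<odot> a1 \<oplus> r \<odot> a1 \<odot> qconj r \<oplus> l \<odot> a2 \<odot> qconj l"
    by (simp add: s hform_def Q.left_diff_distrib Q.right_diff_distrib) (simp add: algebra_simps)
  also have "\<dots> = \<sigma> \<ominus> qconj \<sigma>"
    unfolding eq[symmetric] by (simp add: \<sigma>_def conj_a Q.left_diff_distrib Q.right_diff_distrib)
      (simp add: algebra_simps)
  finally show "rot_data A a1 a2 (s, \<sigma>)" using s0 by (simp add: rot_data_def)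
  have "h s1 s = \<sigma>" by (simp add: s s1_def hform_def \<sigma>_def)
  then show "R (s, \<sigma>) s1 = (r, l)"
    using s0 by (simp add: rot_def s s1_def vsub_def vsmult_def)
qed

text \<open>\<open>g\<close> is the rotation of \<open>witt_rotation\<close> composed with a map
  fixing \<open>s1\<close>, whose spinor norm lies in \<open>normK\<close>; and
  \<open>N \<sigma>\<close> is \<open>N (qone \<ominus> r)\<close> times the norm
  \<open>N a1\<close>.\<close>

lemma spin_norm_iff:
  assumes g: "lin_iso g" "spin g n" "g s1 = (r, l)" and r: "r \<noteq> qone"
  shows "n \<in> normK \<longleftrightarrow> N (qone \<ominus> r) \<in> normK"
proof -
  have "h (g s1) (g s1) = h s1 s1" using g(1) unfolding lin_iso_def by blast
  then have "r \<odot> a1 \<odot> qconj r \<oplus> l \<odot> a2 \<odot> qconj l = a1"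
    unfolding g(3) by (simp add: hform_def s1_def)
  then have eq: "a1 \<ominus> r \<odot> a1 \<odot> qconj r = l \<odot> a2 \<odot> qconj l" by (simp add: Q.diff_eq_eq Q.add.commute)
  define s \<sigma> where "s = vsub (vsmult A (qone \<ominus> r) s1) (vsmult A l s2)" and "\<sigma> = a1 \<odot> (qone \<ominus> qconj r)"
  note w = witt_rotation[OF r eq, folded s_def \<sigma>_def]
  define f where "f = R (s, qneg (qconj \<sigma>)) \<circ> g"
  have "f s1 = s1" using rot_inverse[OF w(1), of s1] w(2) g(3) by (simp add: f_def)
  moreover have "lin_iso f"
    using g(1) rot_form[OF rot_data_conj[OF w(1)]] by (simp add: lin_iso_def f_def rot_linear)
  ultimately obtain n' where n': "n' \<in> normK" "spin f n'" using spin_fixing_s1 by blast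
  have "R (s, \<sigma>) \<circ> f = g" by (rule ext) (simp add: f_def rot_conj_inverse[OF w(1)])
  then have "spin g (N \<sigma> * n')" using spin_comp[OF spin_rot[OF w(1)] n'(2)] by simp
  then obtain e where e: "e \<noteq> 0" "n = N \<sigma> * n' * (e * e)" using spin_unique[OF g(2)] by blast
  have "N (qone \<ominus> qconj r) = N (qone \<ominus> r)" using qnorm_simps(2)[of "qone \<ominus> r"] by simp
  then have "n = n' * (N a1 * N (qone \<ominus> r)) * (e * e)" using e by (simp add: \<sigma>_def mult_ac)
  then show ?thesis
    by (simp only: nrm_mult_square_iff[OF e(1)] nrm_mult_left_iff[OF n'(1)] nrm_mult_left_iff[OF N_a1_normK])
qed

lemma spin_norm_iff_neg:
  assumes g: "lin_iso g" "spin g n" "g s1 = (r, l)" and r: "r \<noteq> qneg qone"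
  shows "n \<in> normK \<longleftrightarrow> N (qone \<oplus> r) \<in> normK"
proof -
  define f where "f x = (qneg (fst (g x)), qneg (snd (g x)))" for x
  have "lin_iso f"
    using g(1) by (simp add: lin_iso_def f_def vadd_def vsmult_def hform_def Q.add.commute)
  moreover have "spin f n" using spin_neg[OF g(2)] by (simp add: f_def[abs_def])
  moreover have "f s1 = (qneg r, qneg l)" using g(3) by (simp add: f_def)
  moreover have "qneg r \<noteq> qone" using r by (metis Q.minus_minus)
  ultimately show ?thesis using spin_norm_iff by fastforce
qed

subsection \<open>The lattice\<close>

lemma O_D_iff: "x \<in> O_D v A \<longleftrightarrow> vge v 0 (N x)"
  by (simp add: O_D_def qabs_def absk_le_one_iff)

lemma lattice_iff: "x \<in> lattice v A \<longleftrightarrow> vge v 0 (N (fst x)) \<and> vge v 0 (N (snd x))"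
  by (simp add: lattice_def O_D_iff)

lemma big_iff: "qabs v A x \<ge> qabs v A (qscal 2) \<longleftrightarrow> x \<noteq> qzero \<and> v (N x) \<le> v 4"
  by (simp add: qabs_def absk_le_iff)

text \<open>The last hypothesis makes the coefficient \<open>k\<close> integral, so \<open>x\<close>
  changes by an integral multiple of the lattice vector \<open>s\<close>.\<close>

lemma rot_preserves_lattice:
  assumes "\<rho> \<noteq> qzero" and s: "s \<in> lattice v A" and x: "x \<in> lattice v A"
    and "vge v (v (N \<rho>)) (N (h x s))"
  shows "R (s, \<rho>) x \<in> lattice v A"
proof -
  define k where "k = h x s \<odot> qinv A \<rho>"
  have "vge v 0 (N (h x s) / N \<rho>)" using vge_divide[OF assms(4), of "N \<rho>"] assms(1) by simp
  then have k: "vge v 0 (N k)" by (simp add: k_def divide_inverse)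
  have "R (s, \<rho>) x = (fst x \<ominus> k \<odot> fst s, snd x \<ominus> k \<odot> snd s)"
    by (simp add: rot_def k_def vsub_def vsmult_def)
  then show ?thesis using s x k by (simp add: lattice_iff norm_ultrametric_diff vge_mult0)
qed

lemma norm_one_sub_conj: "N (qone \<ominus> qconj r) = N (qone \<ominus> r)"
  using qnorm_simps(2)[of "qone \<ominus> r"] by simp

text \<open>\<open>h x s\<close> is \<open>fst x \<odot> \<sigma>\<close> minus
  \<open>snd x \<odot> a2 \<odot> qconj l\<close>. The first term is an integral multiple of
  \<open>\<sigma>\<close>; for the second, \<open>|a2| \<le> |2 a1| \<le> |\<sigma>|\<close> by
  \<open>val_a\<close> and \<open>big\<close>. The same estimate serves the inverse
  rotation.\<close>

lemma B_member:
  assumes r: "r \<in> O_D v A" and l: "l \<in> O_D v A"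
    and big: "qabs v A (qone \<ominus> r) \<ge> qabs v A (qscal 2)"
    and eq: "a1 \<ominus> r \<odot> a1 \<odot> qconj r = l \<odot> a2 \<odot> qconj l"
  defines "s \<equiv> vsub (vsmult A (qone \<ominus> r) s1) (vsmult A l s2)" and "\<sigma> \<equiv> a1 \<odot> (qone \<ominus> qconj r)"
  shows "(s, \<sigma>) \<in> Bset v A a1 a2"
proof -
  have r1: "r \<noteq> qone" and vr: "v (N (qone \<ominus> r)) \<le> v 4" using big by (auto simp: big_iff)
  note w = witt_rotation(1)[OF r1 eq, folded s_def \<sigma>_def]
  have s: "s = (qone \<ominus> r, qneg l)" by (simp add: s_def vsub_def vsmult_def s1_def s2_def)
  have sL: "s \<in> lattice v A"
    using r l norm_ultrametric_diff[of 0 qone r] by (simp add: s lattice_iff O_D_iff)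
  have N\<sigma>: "N \<sigma> = N a1 * N (qone \<ominus> r)" by (simp add: \<sigma>_def norm_one_sub_conj)
  have v\<sigma>: "v (N \<sigma>) = v (N a1) + v (N (qone \<ominus> r))"
    unfolding N\<sigma> using a1_nz r1 by (intro v_mult) auto
  have hx: "vge v (v (N \<sigma>)) (N (h x s))" if "x \<in> lattice v A" for x
  proof -
    have "h x s = fst x \<odot> \<sigma> \<ominus> snd x \<odot> a2 \<odot> qconj l"
      by (simp add: hform_def s \<sigma>_def qmul_assoc)
    moreover have "vge v (v (N \<sigma>)) (N (fst x \<odot> \<sigma>))"
      unfolding qnorm_simps using that by (intro vge_mult1) (auto simp: lattice_iff vge_def)
    moreover have "vge v (v (N \<sigma>)) (N (snd x \<odot> a2 \<odot> qconj l))"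
      unfolding qnorm_simps using that l val_a v\<sigma> vr
      by (intro vge_mult0 vge_mult1) (auto simp: lattice_iff vge_def O_D_iff)
    ultimately show ?thesis by (simp add: norm_ultrametric_diff)
  qed
  have "R (s, \<sigma>) \<in> stab v A a1 a2"
  proof (rule rot_stab[OF w])
    fix x assume x: "x \<in> lattice v A"
    show "R (s, \<sigma>) x \<in> lattice v A"
      by (rule rot_preserves_lattice[OF rot_dataD(1)[OF w] sL x hx[OF x]])
    show "R (s, qneg (qconj \<sigma>)) x \<in> lattice v A"
      by (rule rot_preserves_lattice[OF rot_dataD(1)[OF rot_data_conj[OF w]] sL x]) (simp add: hx[OF x])
  qed
  then show ?thesis using w r l big unfolding Bset_def s_def \<sigma>_def by blast
qed

lemma B_witness:
  assumes "r \<in> O_D v A" "l \<in> O_D v A" "qabs v A (qone \<ominus> r) \<ge> qabs v A (qscal 2)"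
    "a1 \<ominus> r \<odot> a1 \<odot> qconj r = l \<odot> a2 \<odot> qconj l" "N (qone \<ominus> r) \<notin> normK"
  shows "\<exists>(s, \<sigma>) \<in> Bset v A a1 a2. N \<sigma> \<notin> normK"
proof -
  have "N (a1 \<odot> (qone \<ominus> qconj r)) \<notin> normK"
    using assms(5) nrm_mult_left_iff[OF N_a1_normK] by (simp add: norm_one_sub_conj)
  then show ?thesis using B_member[OF assms(1-4)] by blast
qed

text \<open>The two elements add up to 2, so by the ultrametric inequality they cannot both be
  smaller than 2.\<close>

lemma big_or_big_neg:
  "qabs v A (qone \<ominus> r) \<ge> qabs v A (qscal 2) \<or> qabs v A (qone \<ominus> qneg r) \<ge> qabs v A (qscal 2)"
proof (rule ccontr)
  assume "\<not> ?thesis"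
  then have "vge v (v 4 + 1) (N (qone \<ominus> r))" "vge v (v 4 + 1) (N (qone \<oplus> r))"
    by (auto simp: big_iff vge_def)
  from norm_ultrametric[OF this] have "vge v (v 4 + 1) (N ((qone \<ominus> r) \<oplus> (qone \<oplus> r)))" .
  moreover have "(qone \<ominus> r) \<oplus> (qone \<oplus> r) = qscal 2"
    by (cases r) (simp add: qone_def qscal_def qsub_def)
  ultimately show False by (simp add: vge_def)
qed

text \<open>Either \<open>g\<close> or its negative meets the size bound, and the equation is
  unchanged when \<open>r\<close> and \<open>l\<close> change sign. Integrality is asked only of the
  image of \<open>s1\<close>, so this serves both for stabilizer elements and for the rotation built
  from condition (3).\<close>

lemma B_witness_of_isometry:
  assumes g: "lin_iso g" "spin g n" "g s1 = (r, l)" and n: "n \<notin> normK"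
    and rl: "r \<in> O_D v A" "l \<in> O_D v A"
  shows "\<exists>(s, \<sigma>) \<in> Bset v A a1 a2. N \<sigma> \<notin> normK"
proof -
  have "h (g s1) (g s1) = h s1 s1" using g(1) unfolding lin_iso_def by blast
  then have "r \<odot> a1 \<odot> qconj r \<oplus> l \<odot> a2 \<odot> qconj l = a1"
    unfolding g(3) by (simp add: hform_def s1_def)
  then have eq: "a1 \<ominus> r \<odot> a1 \<odot> qconj r = l \<odot> a2 \<odot> qconj l" by (simp add: Q.diff_eq_eq Q.add.commute)
  from big_or_big_neg[of r] show ?thesis
  proof
    assume big: "qabs v A (qone \<ominus> r) \<ge> qabs v A (qscal 2)"
    then have "r \<noteq> qone" by (auto simp: big_iff)
    then show ?thesis using B_witness[OF rl big eq] spin_norm_iff[OF g] n by blast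
  next
    assume big: "qabs v A (qone \<ominus> qneg r) \<ge> qabs v A (qscal 2)"
    then have "r \<noteq> qneg qone" by (auto simp: big_iff)
    then have "N (qone \<ominus> qneg r) \<notin> normK" using spin_norm_iff_neg[OF g] n by simp
    then show ?thesis using B_witness[OF _ _ big, of "qneg l"] rl eq by (simp add: O_D_iff)
  qed
qed

section \<open>The group \<open>H(\<Lambda>)\<close> and the set \<open>B(\<Lambda>)\<close>\<close>

lemma s1_lattice: "s1 \<in> lattice v A"
  by (simp add: lattice_iff s1_def)

lemma B_witness_of_Hgrp:
  assumes "Hgrp v A a1 a2 = - {0}"
  shows "\<exists>(s, \<sigma>) \<in> Bset v A a1 a2. N \<sigma> \<notin> normK"
proof -
  obtain j where j: "j \<noteq> qzero" "- N j \<notin> normK"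
    using anticommuting_exists[OF pure1 a1_nz] anticommuting_nonnorm[OF pure1 a1_nz] by blast
  then have "- N j \<in> Hgrp v A a1 a2" using assms by simp
  then obtain ps e where ps: "list_all (rot_data A a1 a2) ps"
    and st: "foldr (\<circ>) (map R ps) id \<in> stab v A a1 a2"
    and e: "e \<noteq> 0" "prod_list (map (\<lambda>p. N (snd p)) ps) = - N j * (e * e)"
    unfolding Hgrp_def by blast
  define g where "g = foldr (\<circ>) (map R ps) id"
  have sp: "spin g (- N j * (e * e))" using spin_rot_list[OF ps] e(2) by (simp add: g_def)
  have n: "- N j * (e * e) \<notin> normK" using j(2) nrm_mult_square_iff[OF e(1)] by blast
  have lin: "lin_iso g" using st unfolding g_def stab_def isometry_def lin_iso_def by blast
  have "g s1 \<in> lattice v A" using st s1_lattice unfolding g_def stab_def by blast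
  then obtain r l where "g s1 = (r, l)" "r \<in> O_D v A" "l \<in> O_D v A"
    by (cases "g s1") (auto simp: lattice_def)
  then show ?thesis using B_witness_of_isometry[OF lin sp _ n] by blast
qed

text \<open>Prepending a rotation multiplies the spinor norm by \<open>N \<sigma>\<close>, and
  \<open>N \<sigma> * N \<sigma>\<close> is a square.\<close>

lemma Hgrp_cons:
  assumes p: "rot_data A a1 a2 (s, \<sigma>)" "R (s, \<sigma>) \<in> stab v A a1 a2"
    and c: "c * N \<sigma> \<in> Hgrp v A a1 a2"
  shows "c \<in> Hgrp v A a1 a2"
proof -
  from c obtain ps e where c0: "c * N \<sigma> \<noteq> 0" and ps: "list_all (rot_data A a1 a2) ps"
    and st: "foldr (\<circ>) (map R ps) id \<in> stab v A a1 a2"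
    and e: "e \<noteq> 0" "prod_list (map (\<lambda>p. N (snd p)) ps) = c * N \<sigma> * (e * e)"
    unfolding Hgrp_def by blast
  have "foldr (\<circ>) (map R ((s, \<sigma>) # ps)) id \<in> stab v A a1 a2" using stab_comp[OF p(2) st] by simp
  moreover have "list_all (rot_data A a1 a2) ((s, \<sigma>) # ps)" using p ps by simp
  moreover have "prod_list (map (\<lambda>p. N (snd p)) ((s, \<sigma>) # ps)) = c * ((N \<sigma> * e) * (N \<sigma> * e))"
    using e(2) by (simp add: mult_ac)
  moreover have "N \<sigma> * e \<noteq> 0" using c0 e(1) by simp
  moreover have "c \<noteq> 0" using c0 by auto
  ultimately show ?thesis unfolding Hgrp_def by blast
qed

lemma square_Hgrp:
  assumes "c \<noteq> 0"
  shows "c * c \<in> Hgrp v A a1 a2"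
proof -
  have "id \<in> stab v A a1 a2" by (simp add: stab_def isometry_def)
  then show ?thesis using assms unfolding Hgrp_def
    by (intro CollectI conjI exI[of _ "[]"] exI[of _ "inverse c"]) (simp_all add: field_simps)
qed

text \<open>An element \<open>x + y a1\<close> with \<open>y \<noteq> 0\<close>, divided by
  \<open>2 * y\<close>, satisfies \<open>\<sigma> - conj \<sigma> = a1 = h(s1,s1)\<close>, so it
  defines a rotation along \<open>s1\<close>; \<open>y = 0\<close> gives squares.\<close>

lemma normK_Hgrp:
  assumes "c \<in> normK"
  shows "c \<in> Hgrp v A a1 a2"
proof -
  obtain x y where c: "c \<noteq> 0" "c = x * x - - N a1 * y * y" using assms by (auto simp: nrm_def)
  show ?thesis
  proof (cases "y = 0")
    case True
    then show ?thesis using c square_Hgrp[of x] by auto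
  next
    case False
    define \<sigma> where "\<sigma> = qscal (x / (2 * y)) \<oplus> qsmult (1/2) a1"
    have N\<sigma>: "N \<sigma> * ((2 * y) * (2 * y)) = c"
      unfolding \<sigma>_def qnorm_pure_span[OF pure1] using False by (simp add: c(2) field_simps)
    then have s0: "\<sigma> \<noteq> qzero" using c(1) by auto
    have diff: "\<sigma> \<ominus> qconj \<sigma> = a1"
      by (simp add: \<sigma>_def conj_a) (cases a1, simp add: qsmult_def qscal_def qsub_def)
    have data: "rot_data A a1 a2 (s1, \<sigma>)"
      using s0 diff by (simp add: rot_data_def hform_def s1_def)
    \<comment> \<open>\<open>a1\<close> is a difference of two elements of norm
      \<open>N \<sigma>\<close>, so its quotient by \<open>\<sigma>\<close> is integral and the
      lattice is preserved.\<close>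
    have "vge v (v (N \<sigma>)) (N (\<sigma> \<ominus> qconj \<sigma>))"
      by (rule norm_ultrametric_diff) (simp_all add: vge_def)
    then have hx: "vge v (v (N \<sigma>)) (N (h x s1))" if "x \<in> lattice v A" for x
      using that by (simp add: diff hform_def s1_def lattice_iff vge_mult1)
    have "R (s1, \<sigma>) \<in> stab v A a1 a2"
    proof (rule rot_stab[OF data])
      fix x assume x: "x \<in> lattice v A"
      show "R (s1, \<sigma>) x \<in> lattice v A"
        by (rule rot_preserves_lattice[OF s0 s1_lattice x hx[OF x]])
      show "R (s1, qneg (qconj \<sigma>)) x \<in> lattice v A"
        by (rule rot_preserves_lattice[OF rot_dataD(1)[OF rot_data_conj[OF data]] s1_lattice x])
          (simp add: hx[OF x])
    qed
    moreover have "c * N \<sigma> \<in> Hgrp v A a1 a2"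
    proof -
      have "c * N \<sigma> = (N \<sigma> * (2 * y)) * (N \<sigma> * (2 * y))"
        unfolding N\<sigma>[symmetric] by (simp add: mult_ac)
      moreover have "N \<sigma> * (2 * y) \<noteq> 0" using s0 False by simp
      ultimately show ?thesis using square_Hgrp by metis
    qed
    ultimately show ?thesis using Hgrp_cons[OF data] by blast
  qed
qed

text \<open>By index 2, a \<open>c\<close> outside the norm group becomes a norm after
  multiplication by \<open>N \<sigma>\<close>.\<close>

lemma Hgrp_of_B_witness:
  assumes "(s, \<sigma>) \<in> Bset v A a1 a2" "N \<sigma> \<notin> normK"
  shows "Hgrp v A a1 a2 = - {0}"
proof -
  have p: "rot_data A a1 a2 (s, \<sigma>)" "R (s, \<sigma>) \<in> stab v A a1 a2"
    using assms(1) by (auto simp: Bset_def)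
  have "c \<in> Hgrp v A a1 a2" if "c \<noteq> 0" for c
  proof (cases "c \<in> normK")
    case True
    then show ?thesis by (rule normK_Hgrp)
  next
    case False
    have "c * N \<sigma> \<in> normK"
      using nrm_index_two[of "- N a1" c "N \<sigma>"] a1_nz that rot_dataD(1)[OF p(1)] False assms(2) by auto
    then show ?thesis using Hgrp_cons[OF p] normK_Hgrp by blast
  qed
  then show ?thesis by (auto simp: Hgrp_def)
qed

text \<open>Expanding \<open>\<sigma> - conj \<sigma> = h(s,s)\<close> gives the equation. A
  rotation along \<open>s2\<close> alone, or one with \<open>l = qzero\<close>, has
  \<open>r a conj r = a\<close> for \<open>a = a2\<close> or \<open>a = a1\<close>, and
  \<open>unitary_norm\<close> then puts \<open>N \<sigma>\<close> into \<open>normK\<close>.\<close>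

lemma B_equation:
  assumes B: "(s, \<sigma>) \<in> Bset v A a1 a2" and n: "N \<sigma> \<notin> normK"
  obtains r l where "r \<in> O_D v A" "l \<in> O_D v A" "l \<noteq> qzero"
    "a1 \<ominus> r \<odot> a1 \<odot> qconj r = l \<odot> a2 \<odot> qconj l" "r \<noteq> qone" "N (qone \<ominus> r) \<notin> normK"
proof -
  have data: "rot_data A a1 a2 (s, \<sigma>)" using B by (auto simp: Bset_def)
  note d = rot_dataD[OF data]
  from B obtain r where r: "r \<in> O_D v A" and alt:
    "(\<exists>l \<in> O_D v A. s = vsub (vsmult A (qone \<ominus> r) s1) (vsmult A l s2) \<and> \<sigma> = a1 \<odot> (qone \<ominus> qconj r)) \<or>
     (s = vsub (vsmult A (qone \<ominus> r) s2) vzero \<and> \<sigma> = a2 \<odot> (qone \<ominus> qconj r))"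
    unfolding Bset_def by blast
  have r1: "r \<noteq> qone" using alt d(1) by auto
  have unit: "N (qone \<ominus> r) \<in> normK" if "a = a1 \<or> a = a2" "r \<odot> a \<odot> qconj r = a" for a
    using that r1 unitary_norm[OF pure1 a1_nz] unitary_norm[OF pure2 a2_nz] normK_a2 by metis
  have cancel: "z = a \<ominus> r \<odot> a \<odot> qconj r"
    if "(qone \<ominus> r) \<odot> a \<odot> qconj (qone \<ominus> r) \<oplus> z = a \<odot> (qone \<ominus> qconj r) \<ominus> qconj (a \<odot> (qone \<ominus> qconj r))"
      "qconj a = qneg a" for a z
  proof -
    have "a \<odot> (qone \<ominus> qconj r) \<ominus> qconj (a \<odot> (qone \<ominus> qconj r))
        = (qone \<ominus> r) \<odot> a \<odot> qconj (qone \<ominus> r) \<oplus> (a \<ominus> r \<odot> a \<odot> qconj r)"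
      by (simp add: that(2) Q.left_diff_distrib Q.right_diff_distrib qmul_assoc) (simp add: algebra_simps)
    then show ?thesis using that(1) by simp
  qed
  from alt show ?thesis
  proof
    assume "\<exists>l \<in> O_D v A. s = vsub (vsmult A (qone \<ominus> r) s1) (vsmult A l s2) \<and> \<sigma> = a1 \<odot> (qone \<ominus> qconj r)"
    then obtain l where l: "l \<in> O_D v A" "s = (qone \<ominus> r, qneg l)" "\<sigma> = a1 \<odot> (qone \<ominus> qconj r)"
      by (auto simp: vsub_def vsmult_def s1_def s2_def)
    have "h s s = (qone \<ominus> r) \<odot> a1 \<odot> qconj (qone \<ominus> r) \<oplus> l \<odot> a2 \<odot> qconj l"
      by (simp add: l(2) hform_def)
    then have eq: "l \<odot> a2 \<odot> qconj l = a1 \<ominus> r \<odot> a1 \<odot> qconj r"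
      using d(2) cancel[OF _ conj_a(1)] unfolding l(3) by simp
    have nr: "N (qone \<ominus> r) \<notin> normK"
      using n nrm_mult[OF N_a1_normK] by (auto simp: l(3) norm_one_sub_conj)
    have "l \<noteq> qzero"
    proof
      assume "l = qzero"
      then have "a1 \<ominus> r \<odot> a1 \<odot> qconj r = qzero" using eq[symmetric] by simp
      then show False using nr unit[of a1] by simp
    qed
    then show ?thesis using that[OF r l(1)] eq r1 nr by simp
  next
    assume "s = vsub (vsmult A (qone \<ominus> r) s2) vzero \<and> \<sigma> = a2 \<odot> (qone \<ominus> qconj r)"
    then have l: "s = (qzero, qone \<ominus> r)" "\<sigma> = a2 \<odot> (qone \<ominus> qconj r)"
      by (auto simp: vsub_def vsmult_def s2_def vzero_def)
    have "h s s = (qone \<ominus> r) \<odot> a2 \<odot> qconj (qone \<ominus> r) \<oplus> qzero"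
      by (simp add: l(1) hform_def)
    then have "qzero = a2 \<ominus> r \<odot> a2 \<odot> qconj r"
      using d(2) cancel[OF _ conj_a(2)] unfolding l(2) by simp
    from this[symmetric] have "N (qone \<ominus> r) \<in> normK" using unit[of a2] by simp
    then have "N \<sigma> \<in> normK" using nrm_mult[OF N_a2_normK] by (simp add: l(2) norm_one_sub_conj)
    then show ?thesis using n by simp
  qed
qed

text \<open>\<open>P\<close> stands for \<open>N(\<pi>\<^sup>t)\<close>.\<close>
lemma B_witness_iff:
  assumes P: "P \<noteq> 0" "v P = v (N a2) - v (N a1)"
  shows "(\<exists>(s, \<sigma>) \<in> Bset v A a1 a2. N \<sigma> \<notin> normK) \<longleftrightarrow>
    (\<exists>r \<in> O_D v A. let z = a1 \<ominus> r \<odot> a1 \<odot> qconj r in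
       hilbert (N (qone \<ominus> r)) (- N a1) = -1 \<and> N z * N a1 \<in> nonzero_squares \<and>
       vge v 0 (N z * inverse (P * N a1)))" (is "?B \<longleftrightarrow> ?C")
proof
  \<comment> \<open>\<open>N z\<close> is \<open>N l * N l * N a2\<close> and \<open>P\<close> has
    the valuation of \<open>N a2 / N a1\<close>, so for \<open>l \<noteq> qzero\<close> the quotient
    has valuation \<open>2 * v (N l)\<close>.\<close>
  have val: "vge v 0 (N z * inverse (P * N a1)) \<longleftrightarrow> vge v 0 (N l)" if "z = l \<odot> a2 \<odot> qconj l" for z l
  proof (cases "l = qzero")
    case False
    have Nz: "N z = N l * N l * N a2" using that by (simp add: mult_ac)
    have "N z * inverse (P * N a1) = N z / (P * N a1)" by (simp add: divide_inverse)
    moreover have "v (N z / (P * N a1)) = 2 * v (N l)"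
      unfolding Nz using False P a1_nz a2_nz by (simp add: v_divide v_mult)
    ultimately show ?thesis using False P a1_nz a2_nz by (auto simp: vge_def Nz)
  qed (simp add: that)
  show ?C if ?B
  proof -
    from that obtain s \<sigma> where "(s, \<sigma>) \<in> Bset v A a1 a2" "N \<sigma> \<notin> normK" by blast
    then obtain r l where rl: "r \<in> O_D v A" "l \<in> O_D v A" "l \<noteq> qzero"
      "a1 \<ominus> r \<odot> a1 \<odot> qconj r = l \<odot> a2 \<odot> qconj l" "r \<noteq> qone" "N (qone \<ominus> r) \<notin> normK"
      by (rule B_equation)
    have "hilbert (N (qone \<ominus> r)) (- N a1) = -1"
      using rl hilbert_nrm[OF pure1 a1_nz, of "N (qone \<ominus> r)"] by simp
    moreover have "N (l \<odot> a2 \<odot> qconj l) * N a1 = (N l * N m * N a1) * (N l * N m * N a1)"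
      by (simp add: N_a2 mult_ac)
    then have "N (l \<odot> a2 \<odot> qconj l) * N a1 \<in> nonzero_squares"
      using rl m_nz a1_nz unfolding nonzero_squares_def by (intro CollectI exI[of _ "N l * N m * N a1"]) simp
    ultimately show ?thesis
      using rl val[OF refl, of l] by (intro bexI[OF _ rl(1)]) (simp add: Let_def O_D_iff)
  qed
  show ?B if ?C
  proof -
    from that obtain r where r: "r \<in> O_D v A" and hil: "hilbert (N (qone \<ominus> r)) (- N a1) = -1"
      and sq: "N (a1 \<ominus> r \<odot> a1 \<odot> qconj r) * N a1 \<in> nonzero_squares"
      and int: "vge v 0 (N (a1 \<ominus> r \<odot> a1 \<odot> qconj r) * inverse (P * N a1))"
      by (auto simp: Let_def)
    define z where "z = a1 \<ominus> r \<odot> a1 \<odot> qconj r"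
    obtain c where c: "c \<noteq> 0" "N z * N a1 = c * c" using sq by (auto simp: nonzero_squares_def z_def)
    have z0: "z \<noteq> qzero" using c by auto
    have pz: "pure_quat z" by (simp add: z_def pure_quat_def conj_a qmul_assoc)
    \<comment> \<open>Since \<open>N a2 = N a1 * (N m * N m)\<close>, this choice gives
      \<open>N z = N a2 * (e * e)\<close>, as \<open>pure_represents\<close> requires.\<close>
    define e where "e = c / (N a1 * N m)"
    have "N z = c * c / N a1" using c a1_nz by (simp add: field_simps)
    then have "N z = N a2 * (e * e)" using a1_nz m_nz by (simp add: e_def N_a2)
    moreover have "e \<noteq> 0" using c a1_nz m_nz by (simp add: e_def)
    ultimately obtain l where l: "z = l \<odot> a2 \<odot> qconj l"
      using pure_represents[OF pure2 a2_nz pz z0] by blast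
    then have lO: "l \<in> O_D v A" using val int by (simp add: O_D_iff z_def)
    have r1: "r \<noteq> qone" using z0 by (auto simp: z_def)
    have nr: "N (qone \<ominus> r) \<notin> normK"
      using hil hilbert_nrm[OF pure1 a1_nz, of "N (qone \<ominus> r)"] r1 by simp
    have eq: "a1 \<ominus> r \<odot> a1 \<odot> qconj r = l \<odot> a2 \<odot> qconj l" using l by (simp add: z_def)
    note w = witt_rotation[OF r1 eq]
    have "lin_iso (R (vsub (vsmult A (qone \<ominus> r) s1) (vsmult A l s2), a1 \<odot> (qone \<ominus> qconj r)))"
      unfolding lin_iso_def using rot_linear rot_form[OF w(1)] by blast
    moreover have "N (a1 \<odot> (qone \<ominus> qconj r)) \<notin> normK"
      using nr nrm_mult_left_iff[OF N_a1_normK] by (simp add: norm_one_sub_conj)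
    \<comment> \<open>Condition (3) gives no lower bound for \<open>|1 - r|\<close>; passing through
      the isometry allows \<open>r\<close> to be replaced by its negative.\<close>
    ultimately show ?thesis using B_witness_of_isometry[OF _ spin_rot[OF w(1)] w(2) _ r lO] by blast
  qed
qed

end

theorem theorem3:
  fixes v :: "'k::field_char_0 \<Rightarrow> int" and \<pi> :: 'k and A :: "'k \<times> 'k"
    and a1 a2 :: "'k quat" and t :: int
  assumes k: "dyadic_local_field v"
    and unif: "\<pi> \<noteq> 0" "v \<pi> = 1"
    and D: "quat_division A"
    and a: "pure_quat a1" "pure_quat a2" "a1 \<noteq> qzero" "a2 \<noteq> qzero"
    and le: "qabs v A (qmul A (qscal 2) a1) \<ge> qabs v A a2"
    and sq: "qnorm A a2 \<in> {qnorm A a1 * c | c. c \<in> nonzero_squares}"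
    and t: "qval v A (qscal (\<pi> powi t)) = qval v A a2 - qval v A a1"
  shows "(Hgrp v A a1 a2 = - {0} \<longleftrightarrow>
           (\<exists>(s, \<sigma>) \<in> Bset v A a1 a2. qnorm A \<sigma> \<notin> norms_from A a1))
       \<and> ((\<exists>(s, \<sigma>) \<in> Bset v A a1 a2. qnorm A \<sigma> \<notin> norms_from A a1) \<longleftrightarrow>
           (\<exists>r \<in> O_D v A.
              let z = qsub a1 (qmul A (qmul A r a1) (qconj r)) in
              hilbert (qnorm A (qsub qone r)) (- qnorm A a1) = -1 \<and>
              qnorm A z * qnorm A a1 \<in> nonzero_squares \<and>
              absk v (qnorm A z * inverse (qnorm A (qmul A (qscal (\<pi> powi t)) a1))) \<le> 1))"
proof -
  interpret local_quaternions v A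
    using k D by unfold_locales
  obtain c where c: "c \<noteq> 0" "N a2 = N a1 * (c * c)" using sq by (auto simp: nonzero_squares_def)
  \<comment> \<open>\<open>qneg a2\<close> is pure and has the norm of \<open>a2\<close>, so it is
    represented by \<open>a1\<close>; this makes the plane hyperbolic.\<close>
  obtain m where m: "m \<noteq> qzero" "qneg a2 = m \<odot> a1 \<odot> qconj m"
    using pure_represents[OF a(1,3), of "qneg a2" c] a c by (auto simp: pure_quat_def)
  have "v (N a2) \<ge> v (4 * N a1)"
    using le a by (simp add: qabs_def absk_le_iff)
  then have val: "v 4 + v (N a1) \<le> v (N a2)" using v_mult[of 4 "N a1"] a by simp
  interpret skew_plane v A a1 a2 m
    using a m val by unfold_locales simp_all
  define P where "P = \<pi> powi t * \<pi> powi t"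
  have P: "P \<noteq> 0" "v P = v (N a2) - v (N a1)" using unif t by (simp_all add: P_def qval_def)
  have NP: "N (qscal (\<pi> powi t) \<odot> a1) = P * N a1" by (simp add: P_def)
  have "Hgrp v A a1 a2 = - {0} \<longleftrightarrow> (\<exists>(s, \<sigma>) \<in> Bset v A a1 a2. N \<sigma> \<notin> normK)"
    using B_witness_of_Hgrp Hgrp_of_B_witness by blast
  then show ?thesis
    unfolding norms_from_eq_nrm[OF a(1,3)] absk_le_one_iff NP using B_witness_iff[OF P] by blast
qed

end
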